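(* (I) Up to isomorphism, there are only five complex $4$-dimensional nilpotent symmetric Leibniz algebras that are not $2$-step nilpotent. Explicitly, every complex $4$-dimensional nilpotent symmetric Leibniz algebra is either $2$-step nilpotent or isomorphic to one algebra from the following list: \begin{itemize} \item $\mathcal{S}_{01}$: $e_1e_1=e_4,\ e_1e_2=e_3,\ e_2e_1=-e_3,\ e_2e_2=e_4,\ e_2e_3=e_4,\ e_3e_2=-e_4$; \item $\mathcal{S}_{02}$: $e_1e_1=e_4,\ e_1e_2=e_3,\ e_2e_1=-e_3,\ e_2e_3=e_4,\ e_3e_2=-e_4$; \item $\mathcal{S}_{03}$: $e_1e_2=e_3+e_4,\ e_2e_1=-e_3,\ e_2e_3=e_4,\ e_3e_2=-e_4$; \item $\mathcal{S}_{04}$: $e_1e_2=e_3,\ e_2e_1=-e_3,\ e_2e_2=e_4,\ e_2e_3=e_4,\ e_3e_2=-e_4$; \item $\mathcal{S}_{05}$: $e_1e_2=e_3,\ e_2e_1=-e_3,\ e_2e_3=e_4,\ e_3e_2=-e_4$. \end{itemize} (II) Up to isomorphism, there are infinitely many complex $4$-dimensional nilpotent weakly associative algebras that are neither commutative nor symmetric Leibniz, and they are described in terms of $2$ one-parameter families and $9$ additional isomorphism classes. Explicitly, every complex $4$-dimensional nilpotent weakly associative algebra is either commutative, or a non-commutative symmetric Leibniz algebra, or isomorphic to one algebra from the following list (with $\alpha\in\mathbb{C}$): \begin{itemize} \item $\mathcal{W}_{01}$: $e_1e_1=e_2,\ e_1e_2=e_4,\ e_1e_3=e_4,\ e_2e_1=e_4,\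 e_3e_3=e_4$; \item $\mathcal{W}_{02}$: $e_1e_1=e_2,\ e_1e_2=e_4,\ e_1e_3=e_4,\ e_2e_1=e_4$; \item $\mathcal{W}_{03}^{\alpha}$: $e_1e_1=e_2,\ e_1e_3=(\alpha+1)e_4,\ e_2e_2=e_4,\ e_3e_1=\alpha e_4$; \item $\mathcal{W}_{04}$: $e_1e_1=e_2,\ e_1e_3=e_4,\ e_2e_2=e_4,\ e_3e_3=e_4$; \item $\mathcal{W}_{05}$: $e_1e_1=e_2,\ e_1e_3=e_4,\ e_2e_3=e_4,\ e_3e_2=e_4$; \item $\mathcal{W}_{06}^{\alpha}$: $e_1e_1=\alpha e_4,\ e_1e_2=e_3+e_4,\ e_2e_1=e_3,\ e_2e_2=e_4,\ e_3e_3=e_4$; \item $\mathcal{W}_{07}$: $e_1e_1=e_4,\ e_1e_2=e_3+e_4,\ e_2e_1=e_3,\ e_3e_3=e_4$; \item $\mathcal{W}_{08}$: $e_1e_2=e_3+e_4,\ e_1e_3=e_4,\ e_2e_1=e_3,\ e_2e_2=e_4,\ e_3e_1=e_4$; \item $\mathcal{W}_{09}$: $e_1e_2=e_3+e_4,\ e_1e_3=e_4,\ e_2e_1=e_3,\ e_2e_3=e_4,\ e_3e_1=e_4,\ e_3e_2=e_4$; \item $\mathcal{W}_{10}$: $e_1e_2=e_3+e_4,\ e_1e_3=e_4,\ e_2e_1=e_3,\ e_3e_1=e_4$; \item $\mathcal{W}_{11}$: $e_1e_2=e_3+e_4,\ e_2e_1=e_3,\ e_3e_3=e_4$. \end{i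temize}
   Context: An algebra is a complex vector space with a bilinear product (not assumed associative, commutative or unital). A symmetric Leibniz algebra is an algebra satisfying the identities $x(yz)=(xy)z+y(xz)$ and $(xy)z=(xz)y+x(yz)$. A weakly associative algebra is an algebra satisfying the identity $(xy)z-x(yz)+(yz)x-y(zx)=(yx)z-y(xz)$. An algebra is nilpotent if there is $k$ such that every product of $k$ elements, with any bracketing, is zero. An algebra is $2$-step nilpotent if all products of three elements vanish, i.e. $(xy)z=0=x(yz)$ for all $x,y,z$ (the zero-product algebra is included). Each listed algebra has basis $e_1,e_2,e_3,e_4$, and all products of basis elements that are not listed are zero.
   Formalization: W07 is isomorphic to the member of the family W06 with α=0, so it is not an additional isomorphism class; the formal theorem states that the listed W algebras are pairwise non-isomorphic except for exactly this pair. *)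

theory Defs
  imports "HOL-Analysis.Analysis"
begin

locale complex_algebra = vector_space sc
  for sc :: "complex \<Rightarrow> 'a::ab_group_add \<Rightarrow> 'a" +
  fixes mul :: "'a \<Rightarrow> 'a \<Rightarrow> 'a"
  assumes linear_right: "\<And>x. Vector_Spaces.linear sc sc (\<lambda>y. mul x y)"
    and linear_left: "\<And>y. Vector_Spaces.linear sc sc (\<lambda>x. mul x y)"

text \<open>Infinite-dimensional spaces are excluded too: the library gives them dimension 0.\<close>

definition complex_algebra4 ::
  "(complex \<Rightarrow> 'a::ab_group_add \<Rightarrow> 'a) \<Rightarrow> ('a \<Rightarrow> 'a \<Rightarrow> 'a) \<Rightarrow> bool" where
  "complex_algebra4 sc mul \<longleftrightarrow>
     complex_algebra sc mul \<and> vector_space.dim sc UNIV = 4"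

definition algebra_isomorphic ::
  "(complex \<Rightarrow> 'a::ab_group_add \<Rightarrow> 'a) \<Rightarrow> ('a \<Rightarrow> 'a \<Rightarrow> 'a) \<Rightarrow>
   (complex \<Rightarrow> 'b::ab_group_add \<Rightarrow> 'b) \<Rightarrow> ('b \<Rightarrow> 'b \<Rightarrow> 'b) \<Rightarrow> bool" where
  "algebra_isomorphic s1 m1 s2 m2 \<longleftrightarrow>
     (\<exists>f. Vector_Spaces.linear s1 s2 f \<and> bij f \<and> (\<forall>x y. f (m1 x y) = m2 (f x) (f y)))"

definition symmetric_leibniz :: "('a::ab_group_add \<Rightarrow> 'a \<Rightarrow> 'a) \<Rightarrow> bool" where
  "symmetric_leibniz m \<longleftrightarrow>
     (\<forall>x y z. m x (m y z) = m (m x y) z + m y (m x z)) \<and>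
     (\<forall>x y z. m (m x y) z = m (m x z) y + m x (m y z))"

definition weakly_associative :: "('a::ab_group_add \<Rightarrow> 'a \<Rightarrow> 'a) \<Rightarrow> bool" where
  "weakly_associative m \<longleftrightarrow>
     (\<forall>x y z. m (m x y) z - m x (m y z) + m (m y z) x - m y (m z x)
              = m (m y x) z - m y (m x z))"

definition commutative_product :: "('a \<Rightarrow> 'a \<Rightarrow> 'a) \<Rightarrow> bool" where
  "commutative_product m \<longleftrightarrow> (\<forall>x y. m x y = m y x)"

text \<open>\<open>bracketed_product m k a\<close>: the element \<open>a\<close> is a product of \<open>k\<close> elements in some
  bracketing. There is no product of 0 elements, so nilpotency has to require \<open>k \<ge> 1\<close>.\<close>

inductive bracketed_product :: "('a \<Rightarrow> 'a \<Rightarrow> 'a) \<Rightarrow> nat \<Rightarrow> 'a \<Rightarrow> bool"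
  for m :: "'a \<Rightarrow> 'a \<Rightarrow> 'a" where
  single: "bracketed_product m 1 a"
| mult: "bracketed_product m i a \<Longrightarrow> bracketed_product m j b \<Longrightarrow>
         bracketed_product m (i + j) (m a b)"

definition nilpotent_product :: "('a::zero \<Rightarrow> 'a \<Rightarrow> 'a) \<Rightarrow> bool" where
  "nilpotent_product m \<longleftrightarrow> (\<exists>k\<ge>1. \<forall>a. bracketed_product m k a \<longrightarrow> a = 0)"

definition two_step_nilpotent :: "('a::zero \<Rightarrow> 'a \<Rightarrow> 'a) \<Rightarrow> bool" where
  "two_step_nilpotent m \<longleftrightarrow> (\<forall>x y z. m (m x y) z = 0 \<and> m x (m y z) = 0)"

text \<open>Isomorphism classes of 4-dimensional complex algebras with property \<open>P\<close>, each represented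
  by the products on \<open>complex ^ 4\<close> that belong to it. No class is lost, since every 4-dimensional
  complex vector space is isomorphic to \<open>complex ^ 4\<close>.\<close>

definition iso_classes4 ::
  "((complex ^ 4 \<Rightarrow> complex ^ 4 \<Rightarrow> complex ^ 4) \<Rightarrow> bool) \<Rightarrow>
   (complex ^ 4 \<Rightarrow> complex ^ 4 \<Rightarrow> complex ^ 4) set set" where
  "iso_classes4 P =
     {m. complex_algebra4 (*s) m \<and> P m} //
     {(m, m'). complex_algebra4 (*s) m \<and> P m \<and> complex_algebra4 (*s) m' \<and> P m' \<and>
               algebra_isomorphic (*s) m (*s) m'}"

text \<open>The index type \<open>4\<close> consists of the numerals 1, 2, 3, 4, where 4 is the same as 0.\<close>

definition e :: "4 \<Rightarrow> complex ^ 4" where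
  "e i = axis i 1"

text \<open>The bilinear product with the given values on pairs of basis vectors; pairs that are
  not listed have product zero.\<close>

definition table_product ::
  "((4 \<times> 4) \<times> (complex ^ 4)) list \<Rightarrow> complex ^ 4 \<Rightarrow> complex ^ 4 \<Rightarrow> complex ^ 4" where
  "table_product T x y =
     (\<Sum>i\<in>UNIV. \<Sum>j\<in>UNIV. (x $ i * y $ j) *s
        (case map_of T (i, j) of None \<Rightarrow> 0 | Some v \<Rightarrow> v))"

datatype S_label = S01 | S02 | S03 | S04 | S05

fun S_table :: "S_label \<Rightarrow> ((4 \<times> 4) \<times> (complex ^ 4)) list" where
  "S_table S01 = [((1,1), e 4), ((1,2), e 3), ((2,1), - e 3), ((2,2), e 4),
                  ((2,3), e 4), ((3,2), - e 4)]"
| "S_table S02 = [((1,1), e 4), ((1,2), e 3), ((2,1), - e 3), ((2,3), e 4), ((3,2), - e 4)]"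
| "S_table S03 = [((1,2), e 3 + e 4), ((2,1), - e 3), ((2,3), e 4), ((3,2), - e 4)]"
| "S_table S04 = [((1,2), e 3), ((2,1), - e 3), ((2,2), e 4), ((2,3), e 4), ((3,2), - e 4)]"
| "S_table S05 = [((1,2), e 3), ((2,1), - e 3), ((2,3), e 4), ((3,2), - e 4)]"

definition S_alg :: "S_label \<Rightarrow> complex ^ 4 \<Rightarrow> complex ^ 4 \<Rightarrow> complex ^ 4" where
  "S_alg l = table_product (S_table l)"

datatype W_label =
  W01 | W02 | W03 complex | W04 | W05 | W06 complex | W07 | W08 | W09 | W10 | W11

fun W_table :: "W_label \<Rightarrow> ((4 \<times> 4) \<times> (complex ^ 4)) list" where
  "W_table W01 = [((1,1), e 2), ((1,2), e 4), ((1,3), e 4), ((2,1), e 4), ((3,3), e 4)]"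
| "W_table W02 = [((1,1), e 2), ((1,2), e 4), ((1,3), e 4), ((2,1), e 4)]"
| "W_table (W03 \<alpha>) = [((1,1), e 2), ((1,3), (\<alpha> + 1) *s e 4), ((2,2), e 4),
                      ((3,1), \<alpha> *s e 4)]"
| "W_table W04 = [((1,1), e 2), ((1,3), e 4), ((2,2), e 4), ((3,3), e 4)]"
| "W_table W05 = [((1,1), e 2), ((1,3), e 4), ((2,3), e 4), ((3,2), e 4)]"
| "W_table (W06 \<alpha>) = [((1,1), \<alpha> *s e 4), ((1,2), e 3 + e 4), ((2,1), e 3), ((2,2), e 4),
                      ((3,3), e 4)]"
| "W_table W07 = [((1,1), e 4), ((1,2), e 3 + e 4), ((2,1), e 3), ((3,3), e 4)]"
| "W_table W08 = [((1,2), e 3 + e 4), ((1,3), e 4), ((2,1), e 3), ((2,2), e 4), ((3,1), e 4)]"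
| "W_table W09 = [((1,2), e 3 + e 4), ((1,3), e 4), ((2,1), e 3), ((2,3), e 4), ((3,1), e 4),
                  ((3,2), e 4)]"
| "W_table W10 = [((1,2), e 3 + e 4), ((1,3), e 4), ((2,1), e 3), ((3,1), e 4)]"
| "W_table W11 = [((1,2), e 3 + e 4), ((2,1), e 3), ((3,3), e 4)]"

definition W_alg :: "W_label \<Rightarrow> complex ^ 4 \<Rightarrow> complex ^ 4 \<Rightarrow> complex ^ 4" where
  "W_alg l = table_product (W_table l)"

text \<open>The list contains one repetition: exchanging the first two basis vectors, with signs,
  identifies the member of the second family with parameter 0 with \<open>W07\<close>.\<close>

lemma W07_iso_W06_0: "algebra_isomorphic (*s) (W_alg W07) (*s) (W_alg (W06 0))"
proof -
  define f :: "complex ^ 4 \<Rightarrow> complex ^ 4" where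
    "f x = x $ 1 *s e 2 - x $ 2 *s e 1 - x $ 3 *s (e 3 + e 4) + x $ 4 *s e 4" for x
  have ev: "f x $ 1 = - (x $ 2)" "f x $ 2 = x $ 1" "f x $ 3 = - (x $ 3)"
    "f x $ 4 = x $ 4 - x $ 3" for x
    by (simp_all add: f_def e_def axis_def)
  have all4: "(\<forall>i::4. P i) \<longleftrightarrow> P 1 \<and> P 2 \<and> P 3 \<and> P 4" for P
    by (rule forall_4)
  have lin: "Vector_Spaces.linear (*s) (*s) f"
    by unfold_locales (simp_all add: vec_eq_iff all4 ev algebra_simps)
  have "f (f (f (f x))) = x" for x
    by (simp add: vec_eq_iff all4 ev)
  then have "bij f"
    by (intro o_bij[of "f \<circ> f \<circ> f"]) (auto simp: fun_eq_iff)
  moreover have "f (W_alg W07 x y) = W_alg (W06 0) (f x) (f y)" for x y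
    unfolding vec_eq_iff all4
    by (simp add: ev W_alg_def table_product_def sum_4 e_def axis_def algebra_simps)
  ultimately show ?thesis
    using lin unfolding algebra_isomorphic_def by blast
qed

end

theory Submission
  imports Defs
begin

text \<open>Write \<open>[x, y] = xy - yx\<close> and \<open>x \<circ> y = (xy + yx) / 2\<close>, so that \<open>xy = x \<circ> y + [x, y] / 2\<close>. Weak associativity
says exactly that every map \<open>[x, \<cdot>]\<close> is a derivation of the product, and the two symmetric Leibniz identities
imply this. Both parts of the theorem therefore follow from one classification: that of the
nilpotent products in dimension 4 for which the maps \<open>[x, \<cdot>]\<close> are derivations.

By nilpotency the algebra has a basis \<open>v\<^sub>1, \<dots>, v\<^sub>4\<close> with \<open>v\<^sub>i v\<^sub>j\<close> in the span of the \<open>v\<^sub>k\<close>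
with \<open>k > max i j\<close> (lemma \<open>nilpotent4_isomorphic_flag_product\<close>). Here the bracket has only four
structure constants, \<open>[v\<^sub>1, v\<^sub>2] = p v\<^sub>3 + q v\<^sub>4\<close>, \<open>[v\<^sub>1, v\<^sub>3] = r v\<^sub>4\<close>, \<open>[v\<^sub>2, v\<^sub>3] = s v\<^sub>4\<close>,
and the derivation property becomes nine short equations between them and the constants of \<open>\<circ>\<close>
(lemma \<open>weakly_associative_flag_productD\<close>). If the product is not commutative, the equations leave
two possibilities (lemma \<open>weakly_associative_nilpotent4_cases\<close>).

If \<open>p \<noteq> 0\<close> and \<open>(r, s) \<noteq> 0\<close>, the bracket is that of the filiform Lie algebra, and \<open>\<circ>\<close> reduces to a
quadratic form on two generators with values on the line of \<open>v\<^sub>4\<close>. These products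
are symmetric Leibniz, and the binary forms modulo the remaining changes of basis, all triangular,
give the five algebras of part (I).

Otherwise the bracket has rank 2 and, up to isomorphism, \<open>[e\<^sub>1, e\<^sub>2] = e\<^sub>4\<close> is the only non-zero
bracket of basis vectors, while \<open>x \<circ> y = b(x, y) e\<^sub>3 + g(x, y) e\<^sub>4\<close> for a symmetric form \<open>b\<close> on
\<open>\<langle>e\<^sub>1, e\<^sub>2\<rangle>\<close> and a symmetric form \<open>g\<close> on \<open>\<langle>e\<^sub>1, e\<^sub>2, e\<^sub>3\<rangle>\<close>. Such a product is symmetric Leibniz if and
only if \<open>b = 0\<close> or \<open>g(e\<^sub>3, \<cdot>) = 0\<close>, and then it is 2-step nilpotent. In the remaining cases \<open>b\<close> has
rank 1, which leads to \<open>W01\<close> to \<open>W05\<close>, or rank 2, which leads to \<open>W06\<close> to \<open>W11\<close>; the finer division is by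
whether \<open>g(e\<^sub>3, e\<^sub>3)\<close> vanishes and by the vector \<open>g(e\<^sub>3, \<cdot>)\<close>.

Isomorphisms within either family are completely described by the equations that the entries of
the matrix of a basis change satisfy (lemmas \<open>heis_isomorphicI\<close>, \<open>heis_isomorphicD\<close>, \<open>filiform_isomorphicI\<close>,
\<open>filiform_isomorphicD\<close>). The same equations serve to reach the normal forms and to separate them.\<close>

section \<open>Algebras and isomorphisms in coordinates\<close>

lemma e_nth [simp]: "e i $ j = (if j = i then 1 else 0)"
  by (simp add: e_def axis_def)

lemma vec4_eq_iff: "(x :: complex ^ 4) = y \<longleftrightarrow> x $ 1 = y $ 1 \<and> x $ 2 = y $ 2 \<and> x $ 3 = y $ 3 \<and> x $ 4 = y $ 4"
  by (simp add: vec_eq_iff forall_4)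

lemma complex_algebra_iff:
  "complex_algebra sc mul \<longleftrightarrow> vector_space sc \<and>
    (\<forall>x y z. mul x (y + z) = mul x y + mul x z) \<and> (\<forall>x y z. mul (x + y) z = mul x z + mul y z) \<and>
    (\<forall>c x y. mul x (sc c y) = sc c (mul x y)) \<and> (\<forall>c x y. mul (sc c x) y = sc c (mul x y))"
  unfolding complex_algebra_def complex_algebra_axioms_def linear_iff_module_hom module_hom_iff vector_space_def module_def
  by auto

lemma complex_algebra4_vec_iff:
  "complex_algebra4 ((*s) :: complex \<Rightarrow> complex ^ 4 \<Rightarrow> complex ^ 4) m \<longleftrightarrow> complex_algebra (*s) m"
  unfolding complex_algebra4_def by (simp add: card_cart_basis)

lemma algebra_isomorphic_sym:
  assumes "algebra_isomorphic s1 m1 s2 m2"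
  shows "algebra_isomorphic s2 m2 s1 m1"
proof -
  obtain f where lin: "Vector_Spaces.linear s1 s2 f" and bij: "bij f"
    and mul: "\<And>x y. f (m1 x y) = m2 (f x) (f y)"
    using assms unfolding algebra_isomorphic_def by blast
  let ?g = "inv f"
  have fg: "f (?g y) = y" for y by (simp add: bij bij_is_surj surj_f_inv_f)
  have gf: "?g (f x) = x" for x by (simp add: bij bij_is_inj)
  have "Vector_Spaces.linear s2 s1 ?g"
    using lin unfolding Vector_Spaces.linear_def module_hom_def module_hom_axioms_def
    by (metis fg gf)
  moreover have "?g (m2 x y) = m1 (?g x) (?g y)" for x y
    by (metis fg gf mul)
  ultimately show ?thesis
    unfolding algebra_isomorphic_def using bij bij_imp_bij_inv by blast
qed

lemma algebra_isomorphic_trans: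
  assumes "algebra_isomorphic s1 m1 s2 m2" and "algebra_isomorphic s2 m2 s3 m3"
  shows "algebra_isomorphic s1 m1 s3 m3"
proof -
  obtain f g where "Vector_Spaces.linear s1 s2 f" "bij f" "\<And>x y. f (m1 x y) = m2 (f x) (f y)"
    and "Vector_Spaces.linear s2 s3 g" "bij g" "\<And>x y. g (m2 x y) = m3 (g x) (g y)"
    using assms unfolding algebra_isomorphic_def by blast
  then show ?thesis
    unfolding algebra_isomorphic_def
    by (intro exI[of _ "g \<circ> f"]) (auto intro: Vector_Spaces.linear_compose bij_comp)
qed

lemma algebra_isomorphic_refl:
  assumes "complex_algebra s m"
  shows "algebra_isomorphic s m s m"
proof -
  have "vector_space s" using assms by (simp add: complex_algebra_iff)
  then have "Vector_Spaces.linear s s id"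
    by (rule vector_space.linear_id)
  then show ?thesis
    unfolding algebra_isomorphic_def by (intro exI[of _ id]) auto
qed

text \<open>Identities are transported by an isomorphism because each of them is a statement about all
  elements and only involves sums and products.\<close>

lemma algebra_isomorphic_imp_iff:
  assumes "algebra_isomorphic s1 m1 s2 m2"
  shows "commutative_product m1 = commutative_product m2"
    and "weakly_associative m1 = weakly_associative m2"
    and "symmetric_leibniz m1 = symmetric_leibniz m2"
    and "two_step_nilpotent m1 = two_step_nilpotent m2"
proof -
  obtain f where lin: "Vector_Spaces.linear s1 s2 f" and bij: "bij f"
    and mul: "\<And>x y. m2 (f x) (f y) = f (m1 x y)"
    using assms unfolding algebra_isomorphic_def by metis
  interpret Vector_Spaces.linear s1 s2 f by (rule lin)
  have f_eq: "f x = f y \<longleftrightarrow> x = y" for x y using bij by (simp add: bij_is_inj inj_eq)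
  have f_0: "f x = 0 \<longleftrightarrow> x = 0" for x using f_eq[of x 0] zero by simp
  have all: "(\<forall>y. P y) \<longleftrightarrow> (\<forall>x. P (f x))" for P
    using bij by (metis bij_pointE)
  show "commutative_product m1 = commutative_product m2"
    unfolding commutative_product_def all by (simp add: mul f_eq)
  show "weakly_associative m1 = weakly_associative m2"
    unfolding weakly_associative_def all by (simp add: mul f_eq flip: add diff)
  show "symmetric_leibniz m1 = symmetric_leibniz m2"
    unfolding symmetric_leibniz_def all by (simp add: mul f_eq flip: add)
  show "two_step_nilpotent m1 = two_step_nilpotent m2"
    unfolding two_step_nilpotent_def all by (simp add: mul f_0)
qed

lemma sum_basis_e: "(\<Sum>i\<in>UNIV. x $ i *s e i) = x"
  by (simp add: vec_eq_iff if_distrib cong: if_cong)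

lemma linear_vec_expand:
  fixes f :: "complex ^ 4 \<Rightarrow> complex ^ 4"
  assumes "Vector_Spaces.linear (*s) (*s) f"
  shows "f x = (\<Sum>i\<in>UNIV. x $ i *s f (e i))"
proof -
  interpret f: Vector_Spaces.linear "(*s)" "(*s)" f by (rule assms)
  have "f x = f (\<Sum>i\<in>UNIV. x $ i *s e i)" by (simp only: sum_basis_e)
  also have "\<dots> = (\<Sum>i\<in>UNIV. x $ i *s f (e i))" by (simp add: f.sum f.scale)
  finally show ?thesis .
qed

lemma complex_algebra_vec_expand:
  fixes m :: "complex ^ 4 \<Rightarrow> complex ^ 4 \<Rightarrow> complex ^ 4"
  assumes "complex_algebra (*s) m"
  shows "m x y = (\<Sum>i\<in>UNIV. \<Sum>j\<in>UNIV. (x $ i * y $ j) *s m (e i) (e j))"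
proof -
  interpret complex_algebra "(*s)" m by (rule assms)
  have "m x y = (\<Sum>i\<in>UNIV. x $ i *s m (e i) y)"
    by (rule linear_vec_expand[OF linear_left])
  also have "\<dots> = (\<Sum>i\<in>UNIV. x $ i *s (\<Sum>j\<in>UNIV. y $ j *s m (e i) (e j)))"
    by (simp only: flip: linear_vec_expand[OF linear_right])
  finally show ?thesis by (simp add: vec.scale_sum_right)
qed

text \<open>For a linear map between algebras on \<open>complex ^ 4\<close>, multiplicativity only has to be tested
  on the 16 pairs of basis vectors, and injectivity suffices because the dimension is finite.\<close>

lemma algebra_isomorphic_vecI:
  fixes f :: "complex ^ 4 \<Rightarrow> complex ^ 4"
  assumes alg: "complex_algebra (*s) m" "complex_algebra (*s) m'"
    and f: "\<And>c x y. f (c *s x + y) = c *s f x + f y"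
    and inj: "\<And>x. f x = 0 \<Longrightarrow> x = 0"
    and mult: "\<forall>i j. f (m (e i) (e j)) = m' (f (e i)) (f (e j))"
  shows "algebra_isomorphic (*s) m (*s) m'"
proof -
  have "f (0 + 0) = f 0 + f 0" using f[of 1 0 0] by simp
  then have "f 0 = 0" by simp
  have lin: "Vector_Spaces.linear (*s) (*s) f"
    by unfold_locales (use f[of 1] f[of _ _ 0] \<open>f 0 = 0\<close> in \<open>simp_all add: algebra_simps\<close>)
  interpret f: Vector_Spaces.linear "(*s)" "(*s)" f by (rule lin)
  interpret m': complex_algebra "(*s)" m' by (rule alg)
  have "f (m x y) = m' (f x) (f y)" for x y
  proof -
    have left: "m' (\<Sum>i\<in>UNIV. a i *s v i) z = (\<Sum>i\<in>UNIV. a i *s m' (v i) z)" for a v z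
    proof -
      interpret l: Vector_Spaces.linear "(*s)" "(*s)" "\<lambda>x. m' x z" by (rule m'.linear_left)
      show ?thesis by (simp add: l.sum l.scale)
    qed
    have right: "m' z (\<Sum>i\<in>UNIV. a i *s v i) = (\<Sum>i\<in>UNIV. a i *s m' z (v i))" for a v z
    proof -
      interpret r: Vector_Spaces.linear "(*s)" "(*s)" "\<lambda>x. m' z x" by (rule m'.linear_right)
      show ?thesis by (simp add: r.sum r.scale)
    qed
    have "f (m x y) = (\<Sum>i\<in>UNIV. \<Sum>j\<in>UNIV. (x $ i * y $ j) *s f (m (e i) (e j)))"
      by (subst complex_algebra_vec_expand[OF alg(1)]) (simp add: f.sum f.scale)
    also have "\<dots> = m' (\<Sum>i\<in>UNIV. x $ i *s f (e i)) (\<Sum>j\<in>UNIV. y $ j *s f (e j))"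
      unfolding left right using mult
      by (subst sum.swap) (simp add: vec.scale_sum_right mult.commute)
    finally show ?thesis by (simp flip: linear_vec_expand[OF lin])
  qed
  moreover have "inj f"
    using inj vec.linear_inj_iff_eq_0[OF lin] by blast
  then have "bij f"
    using vec.linear_inj_imp_surj[OF lin] by (simp add: bij_def)
  ultimately show ?thesis
    unfolding algebra_isomorphic_def using lin by blast
qed

section \<open>Nilpotent algebras are strictly triangular in a suitable basis\<close>

text \<open>The general product that is strictly triangular for the basis \<open>e 1, e 2, e 3, e 4\<close>. The
  capital letters are the structure constants of \<open>x \<circ> y\<close>: \<open>A\<close> for \<open>e 1 \<circ> e 1\<close>, \<open>B\<close> for \<open>e 1 \<circ> e 2\<close>,
  \<open>C\<close> for \<open>e 2 \<circ> e 2\<close> (followed by the number of the coordinate), \<open>D\<close>, \<open>E\<close>, \<open>F\<close> for \<open>e 1 \<circ> e 3\<close>,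
  \<open>e 2 \<circ> e 3\<close>, \<open>e 3 \<circ> e 3\<close>. The small letters are those of the bracket:
  \<open>[e 1, e 2] = p e 3 + q e 4\<close>, \<open>[e 1, e 3] = r e 4\<close>, \<open>[e 2, e 3] = s e 4\<close>.\<close>

definition flag_product ::
  "complex \<Rightarrow> complex \<Rightarrow> complex \<Rightarrow> complex \<Rightarrow> complex \<Rightarrow> complex \<Rightarrow>
  complex \<Rightarrow> complex \<Rightarrow> complex \<Rightarrow>
  complex \<Rightarrow> complex \<Rightarrow> complex \<Rightarrow> complex \<Rightarrow> complex \<Rightarrow> complex ^ 4 \<Rightarrow> complex ^ 4 \<Rightarrow> complex ^ 4" where
  "flag_product A2 A3 A4 B3 B4 C3 C4 D E F p q r s x y =
     (A2 * (x $ 1 * y $ 1)) *s e 2 +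
     (A3 * (x $ 1 * y $ 1) + B3 * (x $ 1 * y $ 2 + x $ 2 * y $ 1) + C3 * (x $ 2 * y $ 2) +
      p * (x $ 1 * y $ 2 - x $ 2 * y $ 1) / 2) *s e 3 +
     (A4 * (x $ 1 * y $ 1) + B4 * (x $ 1 * y $ 2 + x $ 2 * y $ 1) + C4 * (x $ 2 * y $ 2) +
      D * (x $ 1 * y $ 3 + x $ 3 * y $ 1) + E * (x $ 2 * y $ 3 + x $ 3 * y $ 2) + F * (x $ 3 * y $ 3) +
      (q * (x $ 1 * y $ 2 - x $ 2 * y $ 1) + r * (x $ 1 * y $ 3 - x $ 3 * y $ 1) +
       s * (x $ 2 * y $ 3 - x $ 3 * y $ 2)) / 2) *s e 4"

lemma flag_product_nth [simp]:
  "flag_product A2 A3 A4 B3 B4 C3 C4 D E F p q r s x y $ 1 = 0"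
  "flag_product A2 A3 A4 B3 B4 C3 C4 D E F p q r s x y $ 2 = A2 * (x $ 1 * y $ 1)"
  "flag_product A2 A3 A4 B3 B4 C3 C4 D E F p q r s x y $ 3 =
     A3 * (x $ 1 * y $ 1) + B3 * (x $ 1 * y $ 2 + x $ 2 * y $ 1) + C3 * (x $ 2 * y $ 2) +
     p * (x $ 1 * y $ 2 - x $ 2 * y $ 1) / 2"
  "flag_product A2 A3 A4 B3 B4 C3 C4 D E F p q r s x y $ 4 =
     A4 * (x $ 1 * y $ 1) + B4 * (x $ 1 * y $ 2 + x $ 2 * y $ 1) + C4 * (x $ 2 * y $ 2) +
      D * (x $ 1 * y $ 3 + x $ 3 * y $ 1) + E * (x $ 2 * y $ 3 + x $ 3 * y $ 2) + F * (x $ 3 * y $ 3) +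
      (q * (x $ 1 * y $ 2 - x $ 2 * y $ 1) + r * (x $ 1 * y $ 3 - x $ 3 * y $ 1) +
       s * (x $ 2 * y $ 3 - x $ 3 * y $ 2)) / 2"
  by (simp_all add: flag_product_def)

lemma complex_algebra_flag_product: "complex_algebra (*s) (flag_product A2 A3 A4 B3 B4 C3 C4 D E F p q r s)"
  unfolding complex_algebra_iff using vec.vector_space_axioms
  by (auto simp: vec4_eq_iff algebra_simps diff_divide_distrib add_divide_distrib)

text \<open>This replaces the passage to the quotient by \<open>I\<close> in the construction of a flag: choose
  \<open>k\<close> such that some product \<open>x\<close> of \<open>k\<close> elements lies outside \<open>I\<close>, but no product of \<open>k + 1\<close> elements does.
  Multiplying \<open>x\<close> by anything then leads into \<open>I\<close>.\<close>

lemma nilpotent_annihilator_modulo: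
  fixes I :: "'a::zero set"
  assumes nil: "nilpotent_product m" and "0 \<in> I" and "I \<noteq> UNIV"
  obtains x where "x \<notin> I" and "\<And>y. m x y \<in> I" and "\<And>y. m y x \<in> I"
proof -
  obtain K where "K \<ge> 1" and K: "\<And>a. bracketed_product m K a \<Longrightarrow> a = 0"
    using nil unfolding nilpotent_product_def by blast
  define P where "P k \<longleftrightarrow> (\<exists>a. a \<notin> I \<and> bracketed_product m k a)" for k
  obtain a where "a \<notin> I" using \<open>I \<noteq> UNIV\<close> by blast
  then have "P 1" unfolding P_def using bracketed_product.single[of m a] by blast
  have "\<not> P K" unfolding P_def using K \<open>0 \<in> I\<close> by auto
  have "\<exists>k. P k \<and> \<not> P (Suc k)"
  proof (rule ccontr)
    assume "\<not> ?thesis"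
    then have "P (Suc k)" for k
      by (induction k) (use \<open>P 1\<close> in auto)
    then show False using \<open>\<not> P K\<close> \<open>K \<ge> 1\<close> by (metis Suc_le_D One_nat_def)
  qed
  then obtain k x where x: "x \<notin> I" "bracketed_product m k x" and k: "\<not> P (Suc k)"
    unfolding P_def by blast
  have "m x y \<in> I" "m y x \<in> I" for y
    using k bracketed_product.mult[OF x(2) bracketed_product.single, of y]
      bracketed_product.mult[OF bracketed_product.single x(2), of y]
    unfolding P_def by auto
  with x(1) that show thesis by blast
qed

text \<open>Starting from \<open>{0}\<close>, adjoin four times a vector that annihilates the algebra modulo the span of
  the previous ones. In the resulting basis the product is strictly triangular.\<close>

lemma nilpotent4_isomorphic_flag_product:
  assumes alg: "complex_algebra4 sc mul" and nil: "nilpotent_product mul"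
  obtains A2 A3 A4 B3 B4 C3 C4 D E F p q r s
  where "algebra_isomorphic sc mul (*s) (flag_product A2 A3 A4 B3 B4 C3 C4 D E F p q r s)"
proof -
  interpret complex_algebra sc mul using alg by (simp add: complex_algebra4_def)
  have dim: "dim UNIV = 4" using alg by (simp add: complex_algebra4_def)
  obtain B where B: "independent B" "UNIV \<subseteq> span B" "card B = 4"
    using basis_exists[of UNIV] dim by metis
  then have "finite B" by (metis card.infinite zero_neq_numeral)
  interpret finite_dimensional_vector_space sc B
    by unfold_locales (use B \<open>finite B\<close> in auto)
  have proper: "span W \<noteq> UNIV" if "finite W" "card W < 4" for W
    using dim_le_card[of UNIV W] that dim by auto
  have flag: "\<exists>x. x \<notin> span W \<and> (\<forall>y. mul x y \<in> span W \<and> mul y x \<in> span W)"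
    if "finite W" "card W < 4" for W
    using nilpotent_annihilator_modulo[OF nil span_zero proper[OF that]] by metis
  obtain v4 where v4: "v4 \<notin> span {}" "\<And>y. mul v4 y \<in> span {}" "\<And>y. mul y v4 \<in> span {}"
    using flag[of "{}"] by auto
  obtain v3 where v3: "v3 \<notin> span {v4}" "\<And>y. mul v3 y \<in> span {v4}" "\<And>y. mul y v3 \<in> span {v4}"
    using flag[of "{v4}"] by auto
  have "v3 \<noteq> v4" using v3(1) span_base by blast
  obtain v2 where v2: "v2 \<notin> span {v3, v4}" "\<And>y. mul v2 y \<in> span {v3, v4}"
      "\<And>y. mul y v2 \<in> span {v3, v4}"
    using flag[of "{v3, v4}"] \<open>v3 \<noteq> v4\<close> by auto
  have "v2 \<noteq> v3" "v2 \<noteq> v4" using v2(1) span_base by blast+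
  obtain v1 where v1: "v1 \<notin> span {v2, v3, v4}" "\<And>y. mul v1 y \<in> span {v2, v3, v4}"
      "\<And>y. mul y v1 \<in> span {v2, v3, v4}"
    using flag[of "{v2, v3, v4}"] \<open>v3 \<noteq> v4\<close> \<open>v2 \<noteq> v3\<close> \<open>v2 \<noteq> v4\<close> by auto
  have indep: "independent {v1, v2, v3, v4}"
    using v1(1) v2(1) v3(1) v4(1) by (intro independent_insertI independent_empty)
  have "v1 \<notin> {v2, v3, v4}" using v1(1) span_base[of v1 "{v2, v3, v4}"] by auto
  then have "card {v1, v2, v3, v4} = 4"
    using \<open>v3 \<noteq> v4\<close> \<open>v2 \<noteq> v3\<close> \<open>v2 \<noteq> v4\<close> by simp
  then have spanning: "UNIV \<subseteq> span {v1, v2, v3, v4}"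
    using card_ge_dim_independent[of "{v1, v2, v3, v4}" UNIV] indep dim by simp
  have span1: "\<exists>a. x = sc a v4" if "x \<in> span {v4}" for x
    using that by (simp add: span_breakdown_eq)
  have span2: "\<exists>a b. x = sc a v3 + sc b v4" if "x \<in> span {v3, v4}" for x
  proof -
    from that obtain a where "x - sc a v3 \<in> span {v4}"
      unfolding span_breakdown_eq[of x v3] by blast
    with span1 obtain b where "x - sc a v3 = sc b v4" by blast
    then show ?thesis by (metis add.commute diff_eq_eq)
  qed
  have span3: "\<exists>a b c. x = sc a v2 + sc b v3 + sc c v4" if "x \<in> span {v2, v3, v4}" for x
  proof -
    from that obtain a where "x - sc a v2 \<in> span {v3, v4}"
      unfolding span_breakdown_eq[of x v2] by blast
    with span2 obtain b c where "x - sc a v2 = sc b v3 + sc c v4" by blast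
    then have "x = sc a v2 + sc b v3 + sc c v4" by (simp add: algebra_simps)
    then show ?thesis by blast
  qed
  have span4: "\<exists>a b c d. x = sc a v1 + sc b v2 + sc c v3 + sc d v4" for x
  proof -
    have "x \<in> span {v1, v2, v3, v4}" using spanning by blast
    then obtain a where "x - sc a v1 \<in> span {v2, v3, v4}" unfolding span_breakdown_eq[of x v1] by blast
    with span3 obtain b c d where "x - sc a v1 = sc b v2 + sc c v3 + sc d v4" by blast
    then have "x = sc a v1 + sc b v2 + sc c v3 + sc d v4" by (simp add: algebra_simps)
    then show ?thesis by blast
  qed
  obtain a2 a3 a4 where m11: "mul v1 v1 = sc a2 v2 + sc a3 v3 + sc a4 v4"
    using span3[OF v1(2)] by blast
  obtain b3 b4 where m12: "mul v1 v2 = sc b3 v3 + sc b4 v4" using span2[OF v2(3)] by blast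
  obtain b3' b4' where m21: "mul v2 v1 = sc b3' v3 + sc b4' v4" using span2[OF v2(2)] by blast
  obtain c3 c4 where m22: "mul v2 v2 = sc c3 v3 + sc c4 v4" using span2[OF v2(2)] by blast
  obtain d where m13: "mul v1 v3 = sc d v4" using span1[OF v3(3)] by blast
  obtain d' where m31: "mul v3 v1 = sc d' v4" using span1[OF v3(2)] by blast
  obtain h where m23: "mul v2 v3 = sc h v4" using span1[OF v3(3)] by blast
  obtain h' where m32: "mul v3 v2 = sc h' v4" using span1[OF v3(2)] by blast
  obtain k where m33: "mul v3 v3 = sc k v4" using span1[OF v3(2)] by blast
  have m4: "mul v4 y = 0" "mul y v4 = 0" for y using v4(2,3) by auto
  define f where "f x = sc (x $ 1) v1 + sc (x $ 2) v2 + sc (x $ 3) v3 + sc (x $ 4) v4" for x :: "complex ^ 4"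
  have lin: "Vector_Spaces.linear (*s) sc f"
    by unfold_locales (simp_all add: f_def algebra_simps)
  have "surj f"
  proof -
    have "\<exists>x. y = f x" for y
    proof -
      obtain a b c d where "y = sc a v1 + sc b v2 + sc c v3 + sc d v4"
        using span4 by blast
      then have "y = f (a *s e 1 + b *s e 2 + c *s e 3 + d *s e 4)" by (simp add: f_def)
      then show ?thesis by blast
    qed
    then show ?thesis by blast
  qed
  interpret pair: finite_dimensional_vector_space_pair "(*s)" "cart_basis :: (complex ^ 4) set" sc B
    by unfold_locales
  have "inj f"
    using pair.linear_surjective_imp_injective[OF lin \<open>surj f\<close>] dim B(3) by (simp add: card_cart_basis)
  with \<open>surj f\<close> have "bij f" by (simp add: bij_def)
  have bil: "mul (x + y) z = mul x z + mul y z" "mul z (x + y) = mul z x + mul z y"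
    "mul (sc c x) y = sc c (mul x y)" "mul x (sc c y) = sc c (mul x y)" for x y z c
    using alg by (simp_all add: complex_algebra4_def complex_algebra_iff)
  let ?T = "flag_product a2 a3 a4 ((b3 + b3') / 2) ((b4 + b4') / 2) c3 c4 ((d + d') / 2) ((h + h') / 2) k
     (b3 - b3') (b4 - b4') (d - d') (h - h')"
  have "f (?T x y) = mul (f x) (f y)" for x y
  proof -
    have T3: "?T x y $ 3 = x $ 1 * y $ 1 * a3 + x $ 1 * y $ 2 * b3 + x $ 2 * y $ 1 * b3' + x $ 2 * y $ 2 * c3"
      by (simp add: field_simps)
    have T4: "?T x y $ 4 = x $ 1 * y $ 1 * a4 + x $ 1 * y $ 2 * b4 + x $ 2 * y $ 1 * b4' +
       x $ 2 * y $ 2 * c4 + x $ 1 * y $ 3 * d + x $ 3 * y $ 1 * d' + x $ 2 * y $ 3 * h +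
       x $ 3 * y $ 2 * h' + x $ 3 * y $ 3 * k"
      by (simp add: field_simps)
    have "mul (f x) (f y) = sc (x $ 1 * y $ 1) (mul v1 v1) + sc (x $ 1 * y $ 2) (mul v1 v2) +
      sc (x $ 2 * y $ 1) (mul v2 v1) + sc (x $ 2 * y $ 2) (mul v2 v2) +
      sc (x $ 1 * y $ 3) (mul v1 v3) + sc (x $ 3 * y $ 1) (mul v3 v1) +
      sc (x $ 2 * y $ 3) (mul v2 v3) + sc (x $ 3 * y $ 2) (mul v3 v2) +
      sc (x $ 3 * y $ 3) (mul v3 v3)"
      unfolding f_def bil m4 scale_scale scale_zero_right add_0_right add_0_left scale_right_distrib
      by (simp only: ac_simps)
    also have "\<dots> = sc (x $ 1 * y $ 1 * a2) v2 +
        sc (x $ 1 * y $ 1 * a3 + x $ 1 * y $ 2 * b3 + x $ 2 * y $ 1 * b3' + x $ 2 * y $ 2 * c3) v3 +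
        sc (x $ 1 * y $ 1 * a4 + x $ 1 * y $ 2 * b4 + x $ 2 * y $ 1 * b4' +
          x $ 2 * y $ 2 * c4 + x $ 1 * y $ 3 * d + x $ 3 * y $ 1 * d' + x $ 2 * y $ 3 * h +
          x $ 3 * y $ 2 * h' + x $ 3 * y $ 3 * k) v4"
      unfolding m11 m12 m21 m22 m13 m31 m23 m32 m33 scale_right_distrib scale_left_distrib scale_scale
      by (simp only: ac_simps)
    also have "\<dots> = f (?T x y)"
      unfolding f_def T3 T4 by (simp add: mult.commute)
    finally show ?thesis by simp
  qed
  then have "algebra_isomorphic (*s) ?T sc mul"
    unfolding algebra_isomorphic_def using lin \<open>bij f\<close> by blast
  then show thesis using that algebra_isomorphic_sym by blast
qed

section \<open>The two families with non-commutative product\<close>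

text \<open>Products whose commutator is that of the Heisenberg Lie algebra plus a central line,
  \<open>[e 1, e 2] = e 4\<close>. The symmetric part has the form \<open>b\<close> as its third coordinate and as its fourth the
  form \<open>g\<close>, whose values \<open>g(e 1, e 3)\<close>, \<open>g(e 2, e 3)\<close>, \<open>g(e 3, e 3)\<close> are \<open>l1\<close>, \<open>l2\<close>, \<open>k\<close>.\<close>

definition heis_product ::
  "complex \<Rightarrow> complex \<Rightarrow> complex \<Rightarrow> complex \<Rightarrow> complex \<Rightarrow> complex \<Rightarrow>
  complex \<Rightarrow> complex \<Rightarrow>
  complex \<Rightarrow> complex ^ 4 \<Rightarrow> complex ^ 4 \<Rightarrow> complex ^ 4" where
  "heis_product b11 b12 b22 g11 g12 g22 l1 l2 k x y =
     (b11 * (x $ 1 * y $ 1) + b12 * (x $ 1 * y $ 2 + x $ 2 * y $ 1) + b22 * (x $ 2 * y $ 2)) *s e 3 +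
     (g11 * (x $ 1 * y $ 1) + g12 * (x $ 1 * y $ 2 + x $ 2 * y $ 1) + g22 * (x $ 2 * y $ 2) +
      l1 * (x $ 1 * y $ 3 + x $ 3 * y $ 1) + l2 * (x $ 2 * y $ 3 + x $ 3 * y $ 2) + k * (x $ 3 * y $ 3) +
      (x $ 1 * y $ 2 - x $ 2 * y $ 1) / 2) *s e 4"

lemma heis_product_nth [simp]:
  "heis_product b11 b12 b22 g11 g12 g22 l1 l2 k x y $ 1 = 0"
  "heis_product b11 b12 b22 g11 g12 g22 l1 l2 k x y $ 2 = 0"
  "heis_product b11 b12 b22 g11 g12 g22 l1 l2 k x y $ 3 =
     b11 * (x $ 1 * y $ 1) + b12 * (x $ 1 * y $ 2 + x $ 2 * y $ 1) + b22 * (x $ 2 * y $ 2)"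
  "heis_product b11 b12 b22 g11 g12 g22 l1 l2 k x y $ 4 =
     g11 * (x $ 1 * y $ 1) + g12 * (x $ 1 * y $ 2 + x $ 2 * y $ 1) + g22 * (x $ 2 * y $ 2) +
     l1 * (x $ 1 * y $ 3 + x $ 3 * y $ 1) + l2 * (x $ 2 * y $ 3 + x $ 3 * y $ 2) + k * (x $ 3 * y $ 3) +
     (x $ 1 * y $ 2 - x $ 2 * y $ 1) / 2"
  by (simp_all add: heis_product_def)

lemma complex_algebra_heis_product: "complex_algebra (*s) (heis_product b11 b12 b22 g11 g12 g22 l1 l2 k)"
  unfolding complex_algebra_iff using vec.vector_space_axioms
  by (auto simp: forall_4 vec4_eq_iff algebra_simps diff_divide_distrib add_divide_distrib)

text \<open>Products whose commutator is that of the filiform Lie algebra: \<open>[e 2, e 1]\<close> and \<open>[e 2, e 3]\<close> are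
  non-zero and \<open>e 1\<close>, \<open>e 3\<close> commute. The symmetric part is a binary form with values in the line of
  \<open>e 4\<close>; putting its mixed coefficient \<open>q\<close> on \<open>e 1 e 2\<close> alone only changes the choice of \<open>e 3\<close>.\<close>

definition filiform_product ::
  "complex \<Rightarrow> complex \<Rightarrow> complex \<Rightarrow> complex ^ 4 \<Rightarrow> complex ^ 4 \<Rightarrow> complex ^ 4" where
  "filiform_product p q r x y =
     (x $ 1 * y $ 2 - x $ 2 * y $ 1) *s e 3 +
     (p * (x $ 1 * y $ 1) + q * (x $ 1 * y $ 2) + r * (x $ 2 * y $ 2) +
      (x $ 2 * y $ 3 - x $ 3 * y $ 2)) *s e 4"

lemma filiform_product_nth [simp]:
  "filiform_product p q r x y $ 1 = 0"
  "filiform_product p q r x y $ 2 = 0"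
  "filiform_product p q r x y $ 3 = x $ 1 * y $ 2 - x $ 2 * y $ 1"
  "filiform_product p q r x y $ 4 = p * (x $ 1 * y $ 1) + q * (x $ 1 * y $ 2) + r * (x $ 2 * y $ 2) +
      (x $ 2 * y $ 3 - x $ 3 * y $ 2)"
  by (simp_all add: filiform_product_def)

lemma complex_algebra_filiform_product: "complex_algebra (*s) (filiform_product p q r)"
  unfolding complex_algebra_iff using vec.vector_space_axioms
  by (auto simp: forall_4 vec4_eq_iff algebra_simps)

text \<open>Weak associativity reads \<open>[x, yz] = [x, y] z + y [x, z]\<close>. Each equation is one coordinate of this
  identity for three basis vectors; together they suffice to determine the shape of the product.\<close>

lemma weakly_associative_flag_productD:
  assumes "weakly_associative (flag_product A2 A3 A4 B3 B4 C3 C4 D E F p q r s)"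
  shows "p * A2 = 0" "s * A2 = 0" "q * A2 + r * A3 = 0" "s * A3 = - 2 * (p * D)"
    "r * B3 = p * D" "s * B3 = - (p * E)" "r * C3 = 2 * (p * E)" "s * C3 = 0" "p * F = 0"
proof -
  let ?m = "flag_product A2 A3 A4 B3 B4 C3 C4 D E F p q r s"
  have W: "(?m (?m x y) z - ?m x (?m y z) + ?m (?m y z) x - ?m y (?m z x)) $ i
      = (?m (?m y x) z - ?m y (?m x z)) $ i" for x y z i
    using assms unfolding weakly_associative_def by metis
  show "p * A2 = 0" using W[of "e 1" "e 1" "e 1" 3] by (simp add: field_simps)
  have "- (r * A3) = q * A2" using W[of "e 1" "e 1" "e 1" 4] by (simp add: field_simps)
  then show "q * A2 + r * A3 = 0" by (metis add.left_inverse)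
  show "r * B3 = p * D" using W[of "e 1" "e 1" "e 2" 4] by (simp add: field_simps)
  show "r * C3 = 2 * (p * E)" using W[of "e 1" "e 2" "e 2" 4] by (simp add: field_simps)
  show "p * F = 0" using W[of "e 1" "e 2" "e 3" 4] by (simp add: field_simps)
  have "- (s * A3) = 2 * (p * D)" using W[of "e 2" "e 1" "e 1" 4] by (simp add: field_simps)
  then show "s * A3 = - 2 * (p * D)" by (metis minus_minus mult_minus_left)
  show "s * B3 = - (p * E)" using W[of "e 2" "e 1" "e 2" 4] by (simp add: field_simps, algebra)
  show "s * C3 = 0" using W[of "e 2" "e 2" "e 2" 4] by (simp add: field_simps)
  show "s * A2 = 0" using W[of "e 3" "e 1" "e 1" 4] by (simp add: field_simps)
qed

text \<open>The first basis vector is taken from the line in \<open>\<langle>e 1, e 2\<rangle>\<close> that commutes with \<open>e 3\<close>, the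
  second outside it; their product in reverse order gives the new \<open>- e 3\<close>, and one more
  multiplication the new \<open>e 4\<close>.\<close>

lemma flag_product_isomorphic_filiform:
  assumes "p \<noteq> 0" and "r \<noteq> 0 \<or> s \<noteq> 0"
  shows "\<exists>P Q R. algebra_isomorphic (*s) (flag_product 0 0 A4 0 B4 0 C4 0 0 0 p q r s)
    (*s) (filiform_product P Q R)"
proof (cases "s = 0")
  case False
  let ?n = "4 / (s\<^sup>2 * p)"
  let ?u = "s * (B4 - q / 2) - r * C4"
  have "algebra_isomorphic (*s) (filiform_product ((s\<^sup>2 * A4 - 2 * s * r * B4 + r\<^sup>2 * C4) * ?n)
      ((2 * s * B4 - 2 * r * C4) * ?n) (C4 * ?n)) (*s) (flag_product 0 0 A4 0 B4 0 C4 0 0 0 p q r s)"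
    apply (rule algebra_isomorphic_vecI[OF complex_algebra_filiform_product complex_algebra_flag_product,
        where f = "\<lambda>x. (s * x $ 1) *s e 1 + (x $ 2 - r * x $ 1) *s e 2 +
         (s * p / 2 * x $ 3) *s e 3 + (s\<^sup>2 * p / 4 * x $ 4 - ?u * x $ 3) *s e 4"])
    subgoal by (simp add: vec4_eq_iff field_simps)
    subgoal using assms False by (auto simp: vec4_eq_iff)
    subgoal using assms False by (simp add: forall_4 vec4_eq_iff field_simps power2_eq_square)
    done
  then show ?thesis using algebra_isomorphic_sym by blast
next
  case True
  let ?n = "- 4 / (p * r)"
  have "algebra_isomorphic (*s) (filiform_product (C4 * ?n) (2 * B4 * ?n) (A4 * ?n))
     (*s) (flag_product 0 0 A4 0 B4 0 C4 0 0 0 p q r s)"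
    apply (rule algebra_isomorphic_vecI[OF complex_algebra_filiform_product complex_algebra_flag_product,
        where f = "\<lambda>x. (x $ 2) *s e 1 + (x $ 1) *s e 2 -
         (p / 2 * x $ 3) *s e 3 - (p * r / 4 * x $ 4 + (B4 + q / 2) * x $ 3) *s e 4"])
    subgoal by (simp add: vec4_eq_iff field_simps)
    subgoal using assms True by (auto simp: vec4_eq_iff)
    subgoal using assms True by (simp add: forall_4 vec4_eq_iff field_simps power2_eq_square)
    done
  then show ?thesis using algebra_isomorphic_sym by blast
qed

text \<open>Here \<open>[e 1, e 2] = p e 3 + q e 4\<close> spans all brackets; it becomes the new \<open>e 4\<close>, and the old
  \<open>e 4\<close> becomes the new \<open>e 3\<close>.\<close>

lemma flag_product_isomorphic_heis_bracket_e3: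
  assumes "p \<noteq> 0"
  shows "\<exists>b11 b12 b22 g11 g12 g22 l1 l2 k. algebra_isomorphic
    (*s) (flag_product 0 A3 A4 B3 B4 C3 C4 0 0 0 p q 0 0)
    (*s) (heis_product b11 b12 b22 g11 g12 g22 l1 l2 k)"
proof -
  have "algebra_isomorphic (*s) (heis_product (A4 - A3 * q / p) (B4 - B3 * q / p) (C4 - C3 * q / p)
     (A3 / p) (B3 / p) (C3 / p) 0 0 0) (*s) (flag_product 0 A3 A4 B3 B4 C3 C4 0 0 0 p q 0 0)"
    apply (rule algebra_isomorphic_vecI[OF complex_algebra_heis_product complex_algebra_flag_product,
        where f = "\<lambda>x. x $ 1 *s e 1 + x $ 2 *s e 2 + (p * x $ 4) *s e 3 +
         (x $ 3 + q * x $ 4) *s e 4"])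
    subgoal by (simp add: vec4_eq_iff field_simps)
    subgoal using assms by (auto simp: vec4_eq_iff)
    subgoal using assms by (simp add: forall_4 vec4_eq_iff field_simps)
    done
  then show ?thesis using algebra_isomorphic_sym by blast
qed

text \<open>All brackets are multiples of \<open>e 4\<close>, so the bracket is an alternating form on
  \<open>\<langle>e 1, e 2, e 3\<rangle>\<close>. Its kernel is spanned by \<open>s e 1 - r e 2 + q e 3\<close>, which becomes the new \<open>e 3\<close>.\<close>

lemma flag_product_isomorphic_heis_bracket_e4:
  assumes "q \<noteq> 0 \<or> r \<noteq> 0 \<or> s \<noteq> 0"
    and eqs: "q * A2 + r * A3 = 0" "s * A2 = 0" "s * A3 = 0"
    "r * B3 = 0" "s * B3 = 0" "r * C3 = 0" "s * C3 = 0"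
  shows "\<exists>b11 b12 b22 g11 g12 g22 l1 l2 k. algebra_isomorphic
    (*s) (flag_product A2 A3 A4 B3 B4 C3 C4 D E F 0 q r s)
    (*s) (heis_product b11 b12 b22 g11 g12 g22 l1 l2 k)"
proof -
  consider "q \<noteq> 0" | "q = 0" "r \<noteq> 0" | "q = 0" "r = 0" "s \<noteq> 0" using assms(1) by blast
  then show ?thesis
  proof cases
    case 1
    have A2: "A2 = - (r * A3) / q"
      using eqs(1) 1 by (metis add.commute eq_neg_iff_add_eq_0 mult.commute nonzero_eq_divide_eq)
    have eqs': "s = 0 \<and> r = 0 \<or> s = 0 \<and> B3 = 0 \<and> C3 = 0 \<or> A3 = 0 \<and> B3 = 0 \<and> C3 = 0"
      using eqs by auto
    have "algebra_isomorphic (*s) (heis_product (A3 / q) (B3 / q) (C3 / q) (A4 / q) (B4 / q) (C4 / q)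
       ((s * A4 - r * B4 + q * D) / q) ((s * B4 - r * C4 + q * E) / q)
       ((s\<^sup>2 * A4 + r\<^sup>2 * C4 + q\<^sup>2 * F - 2 * s * r * B4 + 2 * s * q * D - 2 * r * q * E) / q)) (*s)
      (flag_product A2 A3 A4 B3 B4 C3 C4 D E F 0 q r s)"
      apply (rule algebra_isomorphic_vecI[OF complex_algebra_heis_product complex_algebra_flag_product,
        where f = "\<lambda>x. (x $ 1 + s * x $ 3) *s e 1 +
           (x $ 2 - r * x $ 3) *s e 2 + (q * x $ 3) *s e 3 + (q * x $ 4) *s e 4"])
    subgoal by (simp add: vec4_eq_iff ring_distribs)
    subgoal using 1 by (auto simp: vec4_eq_iff)
    subgoal using 1 eqs' by (elim disjE) (simp_all add: A2 forall_4 vec4_eq_iff field_simps power2_eq_square)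
    done
    then show ?thesis using algebra_isomorphic_sym by blast
  next
    case 2
    then have z: "A3 = 0" "B3 = 0" "C3 = 0" "A2 = 0 \<or> s = 0" using eqs by auto
    have "algebra_isomorphic (*s) (heis_product (- A2 / r) 0 0 (A4 / r) (D / r) (F / r)
       ((s * A4 - r * B4) / r) ((s * D - r * E) / r)
       ((s\<^sup>2 * A4 + r\<^sup>2 * C4 - 2 * s * r * B4) / r)) (*s)
      (flag_product A2 A3 A4 B3 B4 C3 C4 D E F 0 q r s)"
      apply (rule algebra_isomorphic_vecI[OF complex_algebra_heis_product complex_algebra_flag_product,
        where f = "\<lambda>x. (x $ 1 + s * x $ 3) *s e 1 -
           (r * x $ 3) *s e 2 + x $ 2 *s e 3 + (r * x $ 4) *s e 4"])
    subgoal by (simp add: vec4_eq_iff ring_distribs)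
    subgoal using 2 by (auto simp: vec4_eq_iff)
    subgoal using 2 z(4) by (elim disjE) (simp_all add: z(1-3) forall_4 vec4_eq_iff field_simps power2_eq_square)
    done
    then show ?thesis using algebra_isomorphic_sym by blast
  next
    case 3
    then have z: "A2 = 0" "A3 = 0" "B3 = 0" "C3 = 0" using eqs by auto
    have "algebra_isomorphic (*s) (heis_product 0 0 0 (C4 / s) (E / s) (F / s) (B4 / s) (D / s) (A4 / s)) (*s)
      (flag_product A2 A3 A4 B3 B4 C3 C4 D E F 0 q r s)"
      apply (rule algebra_isomorphic_vecI[OF complex_algebra_heis_product complex_algebra_flag_product,
        where f = "\<lambda>x. x $ 3 *s e 1 + x $ 1 *s e 2 +
           x $ 2 *s e 3 + (s * x $ 4) *s e 4"])
    subgoal by (simp add: vec4_eq_iff ring_distribs)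
    subgoal using 3 by (auto simp: vec4_eq_iff)
    subgoal using 3 by (simp add: z forall_4 vec4_eq_iff field_simps)
    done
    then show ?thesis using algebra_isomorphic_sym by blast
  qed
qed

text \<open>The case distinction is on the bracket: zero, of Heisenberg type with values in
  \<open>\<langle>e 4\<rangle>\<close>, of Heisenberg type with another line of values, or filiform. In the last case the
  nine equations force the symmetric part into the line of \<open>e 4\<close>.\<close>

lemma weakly_associative_nilpotent4_cases:
  assumes "complex_algebra4 sc mul" and "nilpotent_product mul" and wa: "weakly_associative mul"
  obtains "commutative_product mul"
  | b11 b12 b22 g11 g12 g22 l1 l2 k
    where "algebra_isomorphic sc mul (*s) (heis_product b11 b12 b22 g11 g12 g22 l1 l2 k)"
  | p q r where "algebra_isomorphic sc mul (*s) (filiform_product p q r)"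
proof -
  obtain A2 A3 A4 B3 B4 C3 C4 D E F p q r s
    where iso: "algebra_isomorphic sc mul (*s) (flag_product A2 A3 A4 B3 B4 C3 C4 D E F p q r s)"
    using nilpotent4_isomorphic_flag_product[OF assms(1,2)] by metis
  have "weakly_associative (flag_product A2 A3 A4 B3 B4 C3 C4 D E F p q r s)"
    using wa algebra_isomorphic_imp_iff(2)[OF iso] by simp
  note eqs = weakly_associative_flag_productD[OF this]
  consider "p = 0" "q = 0" "r = 0" "s = 0" | "p = 0" "q \<noteq> 0 \<or> r \<noteq> 0 \<or> s \<noteq> 0"
    | "p \<noteq> 0" "r = 0" "s = 0" | "p \<noteq> 0" "r \<noteq> 0 \<or> s \<noteq> 0" by blast
  then show thesis
  proof cases
    case 1
    then have "commutative_product (flag_product A2 A3 A4 B3 B4 C3 C4 D E F p q r s)"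
      by (simp add: commutative_product_def vec4_eq_iff algebra_simps)
    then show thesis using that(1) algebra_isomorphic_imp_iff(1)[OF iso] by simp
  next
    case 2
    have "s * A3 = 0" "r * B3 = 0" "s * B3 = 0" "r * C3 = 0"
      using eqs \<open>p = 0\<close> by simp_all
    from flag_product_isomorphic_heis_bracket_e4[OF 2(2) eqs(3,2) this(1-4) eqs(8)] iso show thesis
      unfolding \<open>p = 0\<close> by (metis that(2) algebra_isomorphic_trans)
  next
    case 3
    then have "A2 = 0" "D = 0" "E = 0" "F = 0" using eqs by simp_all
    with iso 3 have "algebra_isomorphic sc mul (*s) (flag_product 0 A3 A4 B3 B4 C3 C4 0 0 0 p q 0 0)" by simp
    with flag_product_isomorphic_heis_bracket_e3[OF 3(1)] show thesis
      by (metis that(2) algebra_isomorphic_trans)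
  next
    case 4
    have "A2 = 0" "F = 0" using eqs(1,9) 4 by simp_all
    moreover have "A3 = 0 \<and> B3 = 0 \<and> C3 = 0 \<and> D = 0 \<and> E = 0"
    proof (cases "s = 0")
      case True
      with eqs 4 have "D = 0" "E = 0" "r \<noteq> 0" by simp_all
      with eqs \<open>A2 = 0\<close> show ?thesis by simp
    next
      case False
      with eqs have "C3 = 0" by simp
      with eqs 4 have "E = 0" by simp
      with eqs False have "B3 = 0" by simp
      with eqs 4 have "D = 0" by simp
      with eqs False have "A3 = 0" by simp
      show ?thesis by (intro conjI) fact+
    qed
    ultimately have "algebra_isomorphic sc mul (*s) (flag_product 0 0 A4 0 B4 0 C4 0 0 0 p q r s)"
      using iso by simp
    with flag_product_isomorphic_filiform[OF 4] show thesis
      by (metis that(3) algebra_isomorphic_trans)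
  qed
qed

section \<open>Change of basis within the two families\<close>

text \<open>The new basis is \<open>a11 e 1 + a21 e 2 + s1 e 3\<close>, \<open>a12 e 1 + a22 e 2 + s2 e 3\<close>, \<open>t e 3 + u e 4\<close>,
  \<open>d e 4\<close>, and the equations express the products of the new basis vectors. Thus \<open>b\<close> transforms as a
  form on \<open>\<langle>e 1, e 2\<rangle>\<close> up to the scalar \<open>t\<close>, and \<open>g\<close> as a form on \<open>\<langle>e 1, e 2, e 3\<rangle>\<close>, up to the scalar \<open>d\<close>
  and modulo multiples of \<open>b\<close>.\<close>

lemma heis_isomorphicI:
  assumes d: "d = a11 * a22 - a12 * a21" "d \<noteq> 0" and t: "t \<noteq> 0"
    and b: "t * b11' = b11 * a11\<^sup>2 + 2 * b12 * a11 * a21 + b22 * a21\<^sup>2"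
      "t * b12' = b11 * a11 * a12 + b12 * (a11 * a22 + a21 * a12) + b22 * a21 * a22"
      "t * b22' = b11 * a12\<^sup>2 + 2 * b12 * a12 * a22 + b22 * a22\<^sup>2"
    and g: "u * b11' + d * g11' = g11 * a11\<^sup>2 + 2 * g12 * a11 * a21 + g22 * a21\<^sup>2 +
        2 * s1 * (l1 * a11 + l2 * a21) + k * s1\<^sup>2"
      "u * b12' + d * g12' = g11 * a11 * a12 + g12 * (a11 * a22 + a21 * a12) + g22 * a21 * a22 +
        s1 * (l1 * a12 + l2 * a22) + s2 * (l1 * a11 + l2 * a21) + k * s1 * s2"
      "u * b22' + d * g22' = g11 * a12\<^sup>2 + 2 * g12 * a12 * a22 + g22 * a22\<^sup>2 +
        2 * s2 * (l1 * a12 + l2 * a22) + k * s2\<^sup>2"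
    and l: "d * l1' = t * (l1 * a11 + l2 * a21 + k * s1)" "d * l2' = t * (l1 * a12 + l2 * a22 + k * s2)"
    and k: "d * k' = t\<^sup>2 * k"
  shows "algebra_isomorphic (*s) (heis_product b11 b12 b22 g11 g12 g22 l1 l2 k)
    (*s) (heis_product b11' b12' b22' g11' g12' g22' l1' l2' k')"
proof -
  let ?f = "\<lambda>x :: complex ^ 4. (a11 * x $ 1 + a12 * x $ 2) *s e 1 + (a21 * x $ 1 + a22 * x $ 2) *s e 2 +
    (s1 * x $ 1 + s2 * x $ 2 + t * x $ 3) *s e 3 + (u * x $ 3 + d * x $ 4) *s e 4"
  note g' = g[unfolded add.commute[of "u * _"], folded eq_diff_eq]
  have half: "a11 * a22 / 2 = d / 2 + a12 * a21 / 2" using d(1) by (simp add: diff_divide_distrib)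
  have det: "a11 * (a22 * z) = d * z + a12 * (a21 * z)" for z unfolding d(1) by (simp add: algebra_simps)
  have "algebra_isomorphic (*s) (heis_product b11' b12' b22' g11' g12' g22' l1' l2' k')
    (*s) (heis_product b11 b12 b22 g11 g12 g22 l1 l2 k)"
  proof (rule algebra_isomorphic_vecI[OF complex_algebra_heis_product complex_algebra_heis_product, where f = ?f])
    show "?f (c *s x + y) = c *s ?f x + ?f y" for c x y
      by (simp add: vec4_eq_iff algebra_simps)
    show "x = 0" if "?f x = 0" for x
    proof -
      have e: "a11 * x $ 1 + a12 * x $ 2 = 0" "a21 * x $ 1 + a22 * x $ 2 = 0"
        "s1 * x $ 1 + s2 * x $ 2 + t * x $ 3 = 0" "u * x $ 3 + d * x $ 4 = 0"
        using that by (simp_all add: vec4_eq_iff)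
      have "d * x $ 1 = a22 * (a11 * x $ 1 + a12 * x $ 2) - a12 * (a21 * x $ 1 + a22 * x $ 2)"
        "d * x $ 2 = a11 * (a21 * x $ 1 + a22 * x $ 2) - a21 * (a11 * x $ 1 + a12 * x $ 2)"
        unfolding d(1) by (simp_all add: algebra_simps)
      then have "x $ 1 = 0" "x $ 2 = 0" unfolding e using d(2) by simp_all
      then show "x = 0" using e t d(2) by (simp add: vec4_eq_iff)
    qed
    show "\<forall>i j. ?f (heis_product b11' b12' b22' g11' g12' g22' l1' l2' k' (e i) (e j)) =
        heis_product b11 b12 b22 g11 g12 g22 l1 l2 k (?f (e i)) (?f (e j))"
      using b g' l k half det unfolding forall_4 vec4_eq_iff
      by (simp add: power2_eq_square algebra_simps add_divide_distrib diff_divide_distrib)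
  qed
  then show ?thesis by (rule algebra_isomorphic_sym)
qed

text \<open>The new basis is \<open>c e 1\<close>, \<open>a e 2 + b e 1\<close> and the two vectors that these generate: the line of
  \<open>e 1\<close> modulo the commutators is intrinsic, because it is the one that commutes with \<open>e 3\<close>.\<close>

lemma filiform_isomorphicI:
  assumes "a \<noteq> 0" "c \<noteq> 0" and "a\<^sup>2 * p' = c * p" "a\<^sup>2 * q' = a * q + 2 * b * p"
    "a\<^sup>2 * c * r' = a\<^sup>2 * r + a * b * q + b\<^sup>2 * p"
  shows "algebra_isomorphic (*s) (filiform_product p q r) (*s) (filiform_product p' q' r')"
proof -
  let ?f = "\<lambda>x :: complex ^ 4. (c * x $ 1 + b * x $ 2) *s e 1 + (a * x $ 2) *s e 2 +
     (a * c * x $ 3) *s e 3 + (a\<^sup>2 * c * x $ 4 - b * c * p * x $ 3) *s e 4"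
  have "algebra_isomorphic (*s) (filiform_product p' q' r') (*s) (filiform_product p q r)"
  proof (rule algebra_isomorphic_vecI[OF complex_algebra_filiform_product complex_algebra_filiform_product, where f = ?f])
    show "?f (x *s y + z) = x *s ?f y + ?f z" for x y z
      by (simp add: vec4_eq_iff algebra_simps)
    show "x = 0" if "?f x = 0" for x
      using that assms(1,2) by (auto simp: vec4_eq_iff)
    have "a\<^sup>2 * c * p' = c\<^sup>2 * p" "a\<^sup>2 * c * q' = a * c * q + 2 * b * c * p"
      using arg_cong[OF assms(3), of "\<lambda>x. c * x"] arg_cong[OF assms(4), of "\<lambda>x. c * x"]
      by (simp_all add: algebra_simps power2_eq_square)
    with assms(5) show "\<forall>i j. ?f (filiform_product p' q' r' (e i) (e j)) = filiform_product p q r (?f (e i)) (?f (e j))"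
      unfolding forall_4 vec4_eq_iff by (simp add: power2_eq_square algebra_simps)
  qed
  then show ?thesis by (rule algebra_isomorphic_sym)
qed

text \<open>The converse of \<open>heis_isomorphicI\<close>. An isomorphism preserves \<open>\<langle>e 4\<rangle>\<close>, since it is spanned by the
  commutators, and \<open>\<langle>e 3, e 4\<rangle>\<close>, since these are the elements that commute with everything; this
  gives its matrix the shape used there.\<close>

lemma heis_isomorphicD:
  assumes "algebra_isomorphic (*s) (heis_product b11 b12 b22 g11 g12 g22 l1 l2 k)
    (*s) (heis_product b11' b12' b22' g11' g12' g22' l1' l2' k')"
  obtains a11 a12 a21 a22 s1 s2 t u d where
    "d = a11 * a22 - a12 * a21" "d \<noteq> 0" "t \<noteq> 0"
    "t * b11' = b11 * a11\<^sup>2 + 2 * b12 * a11 * a21 + b22 * a21\<^sup>2"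
    "t * b12' = b11 * a11 * a12 + b12 * (a11 * a22 + a21 * a12) + b22 * a21 * a22"
    "t * b22' = b11 * a12\<^sup>2 + 2 * b12 * a12 * a22 + b22 * a22\<^sup>2"
    "u * b11' + d * g11' = g11 * a11\<^sup>2 + 2 * g12 * a11 * a21 + g22 * a21\<^sup>2 +
        2 * s1 * (l1 * a11 + l2 * a21) + k * s1\<^sup>2"
    "u * b12' + d * g12' = g11 * a11 * a12 + g12 * (a11 * a22 + a21 * a12) + g22 * a21 * a22 +
        s1 * (l1 * a12 + l2 * a22) + s2 * (l1 * a11 + l2 * a21) + k * s1 * s2"
    "u * b22' + d * g22' = g11 * a12\<^sup>2 + 2 * g12 * a12 * a22 + g22 * a22\<^sup>2 +
        2 * s2 * (l1 * a12 + l2 * a22) + k * s2\<^sup>2"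
    "d * l1' = t * (l1 * a11 + l2 * a21 + k * s1)" "d * l2' = t * (l1 * a12 + l2 * a22 + k * s2)"
    "d * k' = t\<^sup>2 * k"
proof -
  let ?m = "heis_product b11 b12 b22 g11 g12 g22 l1 l2 k"
  let ?m' = "heis_product b11' b12' b22' g11' g12' g22' l1' l2' k'"
  obtain f where lin: "Vector_Spaces.linear (*s) (*s) f" and bij: "bij f"
    and mult: "\<And>x y. f (?m' x y) = ?m (f x) (f y)"
    using algebra_isomorphic_sym[OF assms] unfolding algebra_isomorphic_def by blast
  interpret f: Vector_Spaces.linear "(*s)" "(*s)" f by (rule lin)
  have f0: "f x = 0 \<longleftrightarrow> x = 0" for x
    using bij f.zero by (metis bij_is_inj injD)
  have comm: "f (?m' x y - ?m' y x) $ i = (?m (f x) (f y) - ?m (f y) (f x)) $ i" for x y i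
    by (simp add: f.diff mult)
  define d where "d = f (e 1) $ 1 * f (e 2) $ 2 - f (e 2) $ 1 * f (e 1) $ 2"
  have "?m' (e 1) (e 2) - ?m' (e 2) (e 1) = e 4" by (simp add: vec4_eq_iff)
  then have e4': "f (e 4) $ i = (?m (f (e 1)) (f (e 2)) - ?m (f (e 2)) (f (e 1))) $ i" for i
    using comm[of "e 1" "e 2" i] by simp
  then have e4: "f (e 4) = d *s e 4"
    by (simp add: vec4_eq_iff e4' d_def field_simps)
  have "e 4 \<noteq> 0" by (simp add: vec4_eq_iff)
  then have "d \<noteq> 0" using e4 f0[of "e 4"] by auto
  have central: "f (e 3) $ 1 * f (e j) $ 2 = f (e 3) $ 2 * f (e j) $ 1" if "j = 1 \<or> j = 2" for j
  proof -
    have "?m' (e 3) (e j) - ?m' (e j) (e 3) = 0" using that by (auto simp: vec4_eq_iff)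
    then have "f 0 $ 4 = (?m (f (e 3)) (f (e j)) - ?m (f (e j)) (f (e 3))) $ 4"
      using comm[of "e 3" "e j" 4] by simp
    then show ?thesis by (simp add: f.zero field_simps)
  qed
  have "d * f (e 3) $ 1 = f (e 1) $ 1 * (f (e 3) $ 1 * f (e 2) $ 2) - f (e 2) $ 1 * (f (e 3) $ 1 * f (e 1) $ 2)"
    by (simp add: d_def algebra_simps)
  also have "\<dots> = 0" by (simp add: central)
  finally have "f (e 3) $ 1 = 0" using \<open>d \<noteq> 0\<close> by simp
  have "d * f (e 3) $ 2 = f (e 2) $ 2 * (f (e 3) $ 2 * f (e 1) $ 1) - f (e 1) $ 2 * (f (e 3) $ 2 * f (e 2) $ 1)"
    by (simp add: d_def algebra_simps)
  also have "\<dots> = 0" by (simp flip: central)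
  finally have "f (e 3) $ 2 = 0" using \<open>d \<noteq> 0\<close> by simp
  note e3 = \<open>f (e 3) $ 1 = 0\<close> \<open>f (e 3) $ 2 = 0\<close>
  have "f (e 3) $ 3 \<noteq> 0"
  proof
    assume "f (e 3) $ 3 = 0"
    with e3 e4 have "f (d *s e 3 - f (e 3) $ 4 *s e 4) = 0"
      by (simp add: f.diff f.scale vec4_eq_iff)
    then have "d *s e 3 - f (e 3) $ 4 *s e 4 = 0" by (simp only: f0)
    with \<open>d \<noteq> 0\<close> show False by (simp add: vec4_eq_iff)
  qed
  have prod: "?m' x y $ 3 *s f (e 3) + ?m' x y $ 4 *s f (e 4) = ?m (f x) (f y)" for x y
  proof -
    have "?m' x y = ?m' x y $ 3 *s e 3 + ?m' x y $ 4 *s e 4" by (simp add: vec4_eq_iff)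
    then show ?thesis by (metis mult f.add f.scale)
  qed
  have prodc: "?m' x y $ 3 * f (e 3) $ i + ?m' x y $ 4 * f (e 4) $ i = ?m (f x) (f y) $ i" for x y i
    using arg_cong[OF prod, of "\<lambda>v. v $ i" x y]
    by (simp only: vector_add_component vector_smult_component)
  have "f (e 4) $ 3 = 0" "f (e 4) $ 4 = d" by (simp_all add: e4)
  then have prod3: "?m' x y $ 3 * f (e 3) $ 3 = ?m (f x) (f y) $ 3"
    and prod4: "?m' x y $ 3 * f (e 3) $ 4 + ?m' x y $ 4 * d = ?m (f x) (f y) $ 4" for x y
    using prodc[of x y 3] prodc[of x y 4] by (simp_all only: mult_zero_right add_0_right)
  have half: "f (e 1) $ 1 * f (e 2) $ 2 / 2 = d / 2 + f (e 2) $ 1 * f (e 1) $ 2 / 2"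
    by (simp add: d_def diff_divide_distrib)
  show thesis
    apply (rule that[of d "f (e 1) $ 1" "f (e 2) $ 2" "f (e 2) $ 1" "f (e 1) $ 2" "f (e 3) $ 3"
        "f (e 3) $ 4" "f (e 1) $ 3" "f (e 2) $ 3"])
    subgoal by (rule d_def)
    subgoal by (rule \<open>d \<noteq> 0\<close>)
    subgoal by (rule \<open>f (e 3) $ 3 \<noteq> 0\<close>)
    subgoal using prod3[of "e 1" "e 1"] by (simp add: algebra_simps power2_eq_square)
    subgoal using prod3[of "e 1" "e 2"] by (simp add: algebra_simps power2_eq_square)
    subgoal using prod3[of "e 2" "e 2"] by (simp add: algebra_simps power2_eq_square)
    subgoal using prod4[of "e 1" "e 1"] by (simp add: algebra_simps power2_eq_square)
    subgoal using prod4[of "e 1" "e 2"]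
      by (simp add: algebra_simps add_divide_distrib diff_divide_distrib half power2_eq_square)
    subgoal using prod4[of "e 2" "e 2"] by (simp add: algebra_simps power2_eq_square)
    subgoal using prod4[of "e 1" "e 3"] by (simp add: algebra_simps power2_eq_square e3)
    subgoal using prod4[of "e 2" "e 3"] by (simp add: algebra_simps power2_eq_square e3)
    subgoal using prod4[of "e 3" "e 3"] by (simp add: algebra_simps power2_eq_square e3)
    done
qed

text \<open>The converse of \<open>filiform_isomorphicI\<close>. The images of \<open>e 3\<close> and \<open>e 4\<close> are products of
  the images of \<open>e 1\<close> and \<open>e 2\<close>, and \<open>e 1 e 3 = 0\<close> forces the image of \<open>e 1\<close> to have no \<open>e 2\<close>-component.\<close>

lemma filiform_isomorphicD:
  assumes "algebra_isomorphic (*s) (filiform_product p q r) (*s) (filiform_product p' q' r')"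
  obtains a b c where "a \<noteq> 0" "c \<noteq> 0" "a\<^sup>2 * p' = c * p" "a\<^sup>2 * q' = a * q + 2 * b * p"
    "a\<^sup>2 * c * r' = a\<^sup>2 * r + a * b * q + b\<^sup>2 * p"
proof -
  let ?m = "filiform_product p q r"
  let ?m' = "filiform_product p' q' r'"
  obtain f where lin: "Vector_Spaces.linear (*s) (*s) f" and bij: "bij f"
    and mult: "\<And>x y. f (?m' x y) = ?m (f x) (f y)"
    using algebra_isomorphic_sym[OF assms] unfolding algebra_isomorphic_def by blast
  interpret f: Vector_Spaces.linear "(*s)" "(*s)" f by (rule lin)
  have f0: "f x = 0 \<longleftrightarrow> x = 0" for x
    using bij f.zero by (metis bij_is_inj injD)
  obtain c where c: "c = f (e 1) $ 1" by blast
  obtain b where b: "b = f (e 2) $ 1" by blast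
  obtain a where a: "a = f (e 2) $ 2" by blast
  have "?m' (e 2) (e 1) = - e 3" by (simp add: vec4_eq_iff)
  then have "f (e 3) = - ?m (f (e 2)) (f (e 1))"
    using mult[of "e 2" "e 1"] by (metis f.neg minus_minus)
  then have e3: "f (e 3) $ 1 = 0" "f (e 3) $ 2 = 0"
    "f (e 3) $ 3 = c * a - b * f (e 1) $ 2"
    "f (e 3) $ 4 = - ?m (f (e 2)) (f (e 1)) $ 4"
    by (simp_all add: a b c algebra_simps)
  have "?m' (e 2) (e 3) = e 4" by (simp add: vec4_eq_iff)
  then have "f (e 4) = ?m (f (e 2)) (f (e 3))" using mult[of "e 2" "e 3"] by simp
  then have e4: "f (e 4) = (a * f (e 3) $ 3) *s e 4"
    using e3 by (simp add: vec4_eq_iff a)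
  have "e 4 \<noteq> 0" by (simp add: vec4_eq_iff)
  then have nz: "a \<noteq> 0" "f (e 3) $ 3 \<noteq> 0" using e4 f0[of "e 4"] by auto
  have "?m' (e 1) (e 3) = 0" by (simp add: vec4_eq_iff)
  then have "f 0 $ 4 = ?m (f (e 1)) (f (e 3)) $ 4" using mult[of "e 1" "e 3"] by simp
  with nz have e12: "f (e 1) $ 2 = 0" by (simp add: f.zero e3)
  then have e33: "f (e 3) $ 3 = c * a" by (simp add: e3)
  with nz have "c \<noteq> 0" by auto
  have prod: "?m' x y $ 3 * f (e 3) $ 4 + (a * (c * a)) * ?m' x y $ 4 = ?m (f x) (f y) $ 4" for x y
  proof -
    have "?m' x y = ?m' x y $ 3 *s e 3 + ?m' x y $ 4 *s e 4" by (simp add: vec4_eq_iff)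
    then have "?m (f x) (f y) = ?m' x y $ 3 *s f (e 3) + ?m' x y $ 4 *s f (e 4)"
      by (metis mult f.add f.scale)
    then have "?m (f x) (f y) $ 4 = ?m' x y $ 3 * f (e 3) $ 4 + ?m' x y $ 4 * f (e 4) $ 4"
      by (simp only: vector_add_component vector_smult_component)
    moreover have "f (e 4) $ 4 = a * (c * a)" by (simp add: e4 e33)
    ultimately show ?thesis by (simp only: mult.commute)
  qed
  have eqs: "c * (a\<^sup>2 * p') = c * (c * p)" "c * (a\<^sup>2 * q') = c * (a * q + 2 * b * p)"
    "a\<^sup>2 * c * r' = a\<^sup>2 * r + a * b * q + b\<^sup>2 * p"
    subgoal using prod[of "e 1" "e 1"] e12 by (simp add: a b c algebra_simps power2_eq_square)
    subgoal using prod[of "e 1" "e 2"] e12 e3(4) by (simp add: a b c algebra_simps power2_eq_square)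
    subgoal using prod[of "e 2" "e 2"] e12 by (simp add: a b c algebra_simps power2_eq_square)
    done
  show thesis
    using that[OF \<open>a \<noteq> 0\<close> \<open>c \<noteq> 0\<close> _ _ eqs(3)] eqs(1,2) \<open>c \<noteq> 0\<close> by simp
qed

section \<open>Normal forms of the Heisenberg family\<close>

text \<open>The summand \<open>1/2\<close> of \<open>g(e 1, e 2)\<close> adds to or cancels half of the bracket \<open>[e 1, e 2] = e 4\<close>. This
  produces the entries of the multiplication tables in which the two orders of a product differ by \<open>e 4\<close>.\<close>

fun W_normal_form :: "W_label \<Rightarrow> complex ^ 4 \<Rightarrow> complex ^ 4 \<Rightarrow> complex ^ 4" where
  "W_normal_form W01 = heis_product 1 0 0 0 (1/2) 1 1 0 0"
| "W_normal_form W02 = heis_product 1 0 0 0 (1/2) 0 1 0 0"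
| "W_normal_form (W03 \<alpha>) = heis_product 1 0 0 0 (\<alpha> + 1/2) 0 0 0 1"
| "W_normal_form W04 = heis_product 1 0 0 0 (1/2) 1 0 0 1"
| "W_normal_form W05 = heis_product 1 0 0 0 (1/2) 0 0 1 0"
| "W_normal_form (W06 \<alpha>) = heis_product 0 1 0 \<alpha> (1/2) 1 0 0 1"
| "W_normal_form W07 = heis_product 0 1 0 1 (1/2) 0 0 0 1"
| "W_normal_form W08 = heis_product 0 1 0 0 (1/2) 1 1 0 0"
| "W_normal_form W09 = heis_product 0 1 0 0 (1/2) 0 1 1 0"
| "W_normal_form W10 = heis_product 0 1 0 0 (1/2) 0 1 0 0"
| "W_normal_form W11 = heis_product 0 1 0 0 (1/2) 0 0 0 1"

lemma complex_algebra_table_product: "complex_algebra (*s) (table_product T)"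
proof -
  have "table_product T x (y + z) = table_product T x y + table_product T x z"
    "table_product T (x + y) z = table_product T x z + table_product T y z"
    "table_product T x (c *s y) = c *s table_product T x y"
    "table_product T (c *s x) y = c *s table_product T x y" for x y z c
    by (simp_all add: table_product_def ring_distribs vec.scale_left_distrib sum.distrib
      vec.scale_sum_right mult.left_commute mult.assoc)
  then show ?thesis
    unfolding complex_algebra_iff using vec.vector_space_axioms by blast
qed

text \<open>In the tables of \<open>W01\<close> to \<open>W05\<close> the square of \<open>e 1\<close> is called \<open>e 2\<close>; exchanging \<open>e 2\<close> and
  \<open>e 3\<close> gives the Heisenberg form. The other tables have this form as they stand.\<close>

lemma W_alg_isomorphic_normal_form: "algebra_isomorphic (*s) (W_alg l) (*s) (W_normal_form l)"
proof -
  have alg: "complex_algebra (*s) (W_alg l)"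
    unfolding W_alg_def by (rule complex_algebra_table_product)
  have same: ?thesis if "W_alg l = W_normal_form l"
    using algebra_isomorphic_refl[OF alg] that by simp
  let ?f = "\<lambda>x :: complex ^ 4. x $ 1 *s e 1 + x $ 3 *s e 2 + x $ 2 *s e 3 + x $ 4 *s e 4"
  have swap: ?thesis if "\<forall>i j. ?f (W_alg l (e i) (e j)) = W_normal_form l (?f (e i)) (?f (e j))"
  proof (rule algebra_isomorphic_vecI[OF alg])
    show "complex_algebra (*s) (W_normal_form l)" by (cases l) (simp_all add: complex_algebra_heis_product)
    show "?f (c *s x + y) = c *s ?f x + ?f y" for c x y by (simp add: vec4_eq_iff algebra_simps)
    show "x = 0" if "?f x = 0" for x using that by (simp add: vec4_eq_iff)
  qed (rule that)
  note simps = fun_eq_iff vec4_eq_iff W_alg_def table_product_def sum_4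
  show ?thesis
  proof (cases l)
    case (W06 \<alpha>) then show ?thesis by (intro same) (simp add: simps field_simps)
  next
    case W07 then show ?thesis by (intro same) (simp add: simps field_simps)
  next
    case W08 then show ?thesis by (intro same) (simp add: simps field_simps)
  next
    case W09 then show ?thesis by (intro same) (simp add: simps field_simps)
  next
    case W10 then show ?thesis by (intro same) (simp add: simps field_simps)
  next
    case W11 then show ?thesis by (intro same) (simp add: simps field_simps)
  next
    case W01 then show ?thesis by (intro swap) (simp add: simps forall_4 field_simps)
  next
    case W02 then show ?thesis by (intro swap) (simp add: simps forall_4 field_simps)
  next
    case (W03 \<alpha>) then show ?thesis by (intro swap) (simp add: simps forall_4 field_simps)
  next
    case W04 then show ?thesis by (intro swap) (simp add: simps forall_4 field_simps)
  next
    case W05 then show ?thesis by (intro swap) (simp add: simps forall_4 field_simps)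
  qed
qed

text \<open>When only \<open>b\<close> matters, any invertible substitution in \<open>e 1, e 2\<close> that produces the desired \<open>b\<close>
  up to a scalar can be used, whatever it does to \<open>g\<close>.\<close>

lemma heis_change_basis:
  assumes "a11 * a22 - a12 * a21 \<noteq> 0" and "t \<noteq> 0"
    and "t * b11' = b11 * a11\<^sup>2 + 2 * b12 * a11 * a21 + b22 * a21\<^sup>2"
      "t * b12' = b11 * a11 * a12 + b12 * (a11 * a22 + a21 * a12) + b22 * a21 * a22"
      "t * b22' = b11 * a12\<^sup>2 + 2 * b12 * a12 * a22 + b22 * a22\<^sup>2"
  shows "\<exists>g11' g12' g22' l1' l2' k'. algebra_isomorphic (*s) (heis_product b11 b12 b22 g11 g12 g22 l1 l2 k)
    (*s) (heis_product b11' b12' b22' g11' g12' g22' l1' l2' k')"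
proof -
  let ?d = "a11 * a22 - a12 * a21"
  have ex: "\<exists>x. ?d * x = y" for y
    using assms(1) by (intro exI[of _ "y / ?d"]) simp
  obtain g11' where g11: "?d * g11' = g11 * a11\<^sup>2 + 2 * g12 * a11 * a21 + g22 * a21\<^sup>2"
    using ex by blast
  obtain g12' where g12: "?d * g12' = g11 * a11 * a12 + g12 * (a11 * a22 + a21 * a12) + g22 * a21 * a22"
    using ex by blast
  obtain g22' where g22: "?d * g22' = g11 * a12\<^sup>2 + 2 * g12 * a12 * a22 + g22 * a22\<^sup>2"
    using ex by blast
  obtain l1' where l1: "?d * l1' = t * (l1 * a11 + l2 * a21)" using ex by blast
  obtain l2' where l2: "?d * l2' = t * (l1 * a12 + l2 * a22)" using ex by blast
  obtain k' where k: "?d * k' = t\<^sup>2 * k" using ex by blast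
  have "algebra_isomorphic (*s) (heis_product b11 b12 b22 g11 g12 g22 l1 l2 k)
    (*s) (heis_product b11' b12' b22' g11' g12' g22' l1' l2' k')"
    by (rule heis_isomorphicI[OF refl assms, where u = 0 and ?s1.0 = 0 and ?s2.0 = 0])
      (simp_all only: g11 g12 g22 l1 l2 k mult_zero_left mult_zero_right add_0_left add_0_right
        zero_power2)
  then show ?thesis by blast
qed

text \<open>Over the complex numbers a non-zero binary quadratic form is, up to a scalar, either the
  square of a linear form or a product of two independent ones.\<close>

lemma heis_normalize_e3_form:
  assumes "b11 \<noteq> 0 \<or> b12 \<noteq> 0 \<or> b22 \<noteq> 0"
  obtains g11' g12' g22' l1' l2' k' where "algebra_isomorphic (*s)
      (heis_product b11 b12 b22 g11 g12 g22 l1 l2 k) (*s) (heis_product 1 0 0 g11' g12' g22' l1' l2' k')"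
  | g11' g12' g22' l1' l2' k' where "algebra_isomorphic (*s)
      (heis_product b11 b12 b22 g11 g12 g22 l1 l2 k) (*s) (heis_product 0 1 0 g11' g12' g22' l1' l2' k')"
proof -
  define D where "D = b12\<^sup>2 - b11 * b22"
  define r where "r = csqrt D"
  \<comment> \<open>\<open>D\<close> is the discriminant; for \<open>b11 \<noteq> 0\<close> the vectors \<open>(- b12 \<plusminus> r, b11)\<close> are isotropic.\<close>
  have r: "r * r = D" by (simp add: r_def flip: power2_eq_square)
  consider "D \<noteq> 0" "b11 \<noteq> 0" | "D \<noteq> 0" "b11 = 0" | "D = 0" "b11 \<noteq> 0" | "D = 0" "b11 = 0" by blast
  then show thesis
  proof cases
    case 1
    have "r \<noteq> 0" using r 1 by auto
    have "\<exists>g11' g12' g22' l1' l2' k'. algebra_isomorphic (*s)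
      (heis_product b11 b12 b22 g11 g12 g22 l1 l2 k) (*s) (heis_product 0 1 0 g11' g12' g22' l1' l2' k')"
    proof (rule heis_change_basis[of "- b12 + r" b11 "- b12 - r" b11 "- 2 * b11 * D"])
      show "(- b12 + r) * b11 - (- b12 - r) * b11 \<noteq> 0"
        using 1 \<open>r \<noteq> 0\<close> by (simp add: algebra_simps)
    qed (use 1 in \<open>simp_all add: D_def[symmetric] power2_eq_square\<close>,
        insert r, unfold D_def power2_eq_square, algebra+)
    then show thesis using that(2) by blast
  next
    case 2
    then have "b12 \<noteq> 0" by (simp add: D_def)
    have "\<exists>g11' g12' g22' l1' l2' k'. algebra_isomorphic (*s)
      (heis_product b11 b12 b22 g11 g12 g22 l1 l2 k) (*s) (heis_product 0 1 0 g11' g12' g22' l1' l2' k')"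
      by (rule heis_change_basis[of 1 "2 * b12" "- b22" 0 "2 * b12\<^sup>2"])
        (use 2 \<open>b12 \<noteq> 0\<close> in \<open>simp_all add: power2_eq_square algebra_simps\<close>)
    then show thesis using that(2) by blast
  next
    case 3
    have "\<exists>g11' g12' g22' l1' l2' k'. algebra_isomorphic (*s)
      (heis_product b11 b12 b22 g11 g12 g22 l1 l2 k) (*s) (heis_product 1 0 0 g11' g12' g22' l1' l2' k')"
      by (rule heis_change_basis[of 1 b11 "- b12" 0 b11])
        (use 3 in \<open>simp_all add: D_def power2_eq_square algebra_simps\<close>)
    then show thesis using that(1) by blast
  next
    case 4
    then have "b12 = 0" "b22 \<noteq> 0" using assms by (auto simp: D_def)
    have "\<exists>g11' g12' g22' l1' l2' k'. algebra_isomorphic (*s)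
      (heis_product b11 b12 b22 g11 g12 g22 l1 l2 k) (*s) (heis_product 1 0 0 g11' g12' g22' l1' l2' k')"
      by (rule heis_change_basis[of 0 0 1 1 b22])
        (use 4 \<open>b12 = 0\<close> \<open>b22 \<noteq> 0\<close> in \<open>simp_all add: power2_eq_square\<close>)
    then show thesis using that(1) by blast
  qed
qed

text \<open>Completing the square in \<open>g\<close> with respect to \<open>e 3\<close>.\<close>

lemma heis_shift:
  assumes "k \<noteq> 0"
  shows "algebra_isomorphic (*s) (heis_product b11 b12 b22 g11 g12 g22 l1 l2 k)
    (*s) (heis_product b11 b12 b22 (g11 - l1\<^sup>2 / k) (g12 - l1 * l2 / k) (g22 - l2\<^sup>2 / k) 0 0 k)"
  by (rule heis_isomorphicI[where ?a11.0 = 1 and ?a12.0 = 0 and ?a21.0 = 0 and ?a22.0 = 1 and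
      t = 1 and u = 0 and d = 1 and ?s1.0 = "- l1 / k" and ?s2.0 = "- l2 / k"])
    (use assms in \<open>simp_all add: field_simps power2_eq_square\<close>)

text \<open>When \<open>b\<close> is a square, \<open>e 2\<close> spans its radical. The cases are: \<open>k \<noteq> 0\<close>, where \<open>l\<close> can be removed;
  \<open>k = 0\<close> and \<open>l\<close> not zero on the radical; \<open>k = 0\<close> and \<open>l\<close> zero on the radical. A parameter survives
  only if \<open>k \<noteq> 0\<close> and, after removal of \<open>l\<close>, the form \<open>g\<close> vanishes on the radical: then
  \<open>g(e 1, e 2)\<close> scales exactly like the bracket.\<close>

lemma heis_rank1_isomorphic_normal_form:
  assumes "\<not> (l1 = 0 \<and> l2 = 0 \<and> k = 0)"
  shows "\<exists>l. algebra_isomorphic (*s) (heis_product 1 0 0 g11 g12 g22 l1 l2 k) (*s) (W_normal_form l)"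
proof -
  consider (k) "k \<noteq> 0" | (l2) "k = 0" "l2 \<noteq> 0" | (l1) "k = 0" "l2 = 0" "l1 \<noteq> 0"
    using assms by blast
  then show ?thesis
  proof cases
    case k
    define q p u where "q = g12 - l1 * l2 / k" and "p = g22 - l2\<^sup>2 / k" and "u = g11 - l1\<^sup>2 / k"
    note shift = heis_shift[OF k, of 1 0 0 g11 g12 g22 l1 l2, folded q_def p_def u_def]
    have "\<exists>l. algebra_isomorphic (*s) (heis_product 1 0 0 u q p 0 0 k) (*s) (W_normal_form l)"
    proof (cases "p = 0")
      case True
      have "algebra_isomorphic (*s) (heis_product 1 0 0 u q p 0 0 k) (*s) (heis_product 1 0 0 0 (q - 1/2 + 1/2) 0 0 0 1)"
        by (rule heis_isomorphicI[where ?a11.0 = 1 and ?a12.0 = 0 and ?a21.0 = 0 and ?a22.0 = k and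
          t = 1 and u = u and d = k and ?s1.0 = 0 and ?s2.0 = 0])
          (use k True in simp_all)
      then show ?thesis by (metis W_normal_form.simps(3))
    next
      case False
      define a where "a = csqrt (1 / (k * p))"
      have "a\<^sup>2 = 1 / (k * p)" by (simp add: a_def)
      then have a: "a\<^sup>2 * k * p = 1" "a \<noteq> 0" using k False by auto
      \<comment> \<open>Adding a multiple of \<open>e 2\<close> to \<open>e 1\<close> moves \<open>g(e 1, e 2)\<close> to the prescribed value 1/2.\<close>
      define b where "b = a * (1/2 - q) / p"
      have b: "b * p = a * (1/2 - q)" using False by (simp add: b_def)
      have "algebra_isomorphic (*s) (heis_product 1 0 0 u q p 0 0 k) (*s) (heis_product 1 0 0 0 (1/2) 1 0 0 1)"
      proof (rule heis_isomorphicI[where ?a11.0 = a and ?a12.0 = 0 and ?a21.0 = b and ?a22.0 = "a ^ 3 * k" and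
          t = "a\<^sup>2" and u = "u * a\<^sup>2 + 2 * q * a * b + p * b\<^sup>2" and d = "a * (a ^ 3 * k)" and ?s1.0 = 0 and ?s2.0 = 0])
        show "(u * a\<^sup>2 + 2 * q * a * b + p * b\<^sup>2) * 0 + a * (a ^ 3 * k) * (1 / 2) =
          u * a * 0 + q * (a * (a ^ 3 * k) + b * 0) + p * b * (a ^ 3 * k) + 0 * (0 * 0 + 0 * (a ^ 3 * k)) +
            0 * (0 * a + 0 * b) + k * 0 * 0"
          using arg_cong[OF b, of "\<lambda>x. x * (a ^ 3 * k)"] by (simp add: algebra_simps)
        show "(u * a\<^sup>2 + 2 * q * a * b + p * b\<^sup>2) * 0 + a * (a ^ 3 * k) * 1 =
          u * 0\<^sup>2 + 2 * q * 0 * (a ^ 3 * k) + p * (a ^ 3 * k)\<^sup>2 +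
            2 * 0 * (0 * 0 + 0 * (a ^ 3 * k)) + k * 0\<^sup>2"
          using arg_cong[OF a(1), of "\<lambda>x. x * (a ^ 4 * k)"]
          by (simp add: algebra_simps power2_eq_square power3_eq_cube power4_eq_xxxx)
      qed (use a k in \<open>simp_all add: power2_eq_square power3_eq_cube\<close>)
      then show ?thesis by (metis W_normal_form.simps(4))
    qed
    then show ?thesis using algebra_isomorphic_trans[OF shift] by blast
  next
    case l2
    \<comment> \<open>The multiple of \<open>e 2\<close> added to \<open>e 1\<close> removes \<open>l1\<close>, and \<open>e 3\<close>-components of the new \<open>e 1\<close> and
      \<open>e 2\<close> adjust \<open>g(e 1, e 2)\<close> and remove \<open>g(e 2, e 2)\<close>.\<close>
    define a where "a = 1 / l2"
    define b where "b = - l1 / (l2 * l2)"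
    define s1 where "s1 = (a / 2 - g12 * a - g22 * b) / l2"
    have "algebra_isomorphic (*s) (heis_product 1 0 0 g11 g12 g22 l1 l2 k) (*s) (heis_product 1 0 0 0 (1/2) 0 0 1 0)"
      by (rule heis_isomorphicI[where ?a11.0 = a and ?a12.0 = 0 and ?a21.0 = b and ?a22.0 = 1 and
          t = "a\<^sup>2" and u = "g11 * a\<^sup>2 + 2 * g12 * a * b + g22 * b\<^sup>2" and d = a and
          ?s1.0 = s1 and ?s2.0 = "- g22 / (2 * l2)"])
        (use l2 in \<open>simp_all add: a_def b_def s1_def field_simps power2_eq_square\<close>)
    then show ?thesis by (metis W_normal_form.simps(5))
  next
    case l1
    have diag: "algebra_isomorphic (*s) (heis_product 1 0 0 g11 g12 g22 l1 l2 k)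
      (*s) (heis_product 1 0 0 0 (1/2) (a * l1 * g22) 1 0 0)" if "a \<noteq> 0" for a
      by (rule heis_isomorphicI[where ?a11.0 = a and ?a12.0 = 0 and ?a21.0 = 0 and
          ?a22.0 = "a\<^sup>2 * l1" and t = "a\<^sup>2" and u = "g11 * a\<^sup>2" and d = "a * (a\<^sup>2 * l1)" and
          ?s1.0 = 0 and ?s2.0 = "a\<^sup>2 * (1/2 - g12)"])
        (use l1 that in \<open>simp_all add: algebra_simps power2_eq_square\<close>)
    show ?thesis
    proof (cases "g22 = 0")
      case True
      with diag[of 1] show ?thesis by (metis W_normal_form.simps(2) mult_zero_right one_neq_zero)
    next
      case False
      with diag[of "1 / (l1 * g22)"] l1 show ?thesis
        by (simp add: exI[of _ W01])
    qed
  qed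
qed

text \<open>When \<open>b\<close> is hyperbolic, the admissible substitutions are diagonal or antidiagonal in \<open>e 1, e 2\<close>,
  and \<open>g(e 1, e 2)\<close> can be adjusted at will modulo \<open>b\<close>. If \<open>k \<noteq> 0\<close>, then \<open>l\<close> can be removed and the
  product of the two diagonal entries of \<open>g\<close> remains as a parameter. If \<open>k = 0\<close>, each non-zero entry of
  \<open>l\<close> makes it possible to remove the corresponding diagonal entry of \<open>g\<close>.\<close>

lemma heis_rank2_isomorphic_normal_form:
  assumes "\<not> (l1 = 0 \<and> l2 = 0 \<and> k = 0)"
  shows "\<exists>l. algebra_isomorphic (*s) (heis_product 0 1 0 g11 g12 g22 l1 l2 k) (*s) (W_normal_form l)"
proof -
  have main: "\<exists>l. algebra_isomorphic (*s) (heis_product 0 1 0 g11 g12 g22 l1 0 0) (*s) (W_normal_form l)"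
    if "l1 \<noteq> 0" for g11 g12 g22 l1
  proof -
    have diag: "algebra_isomorphic (*s) (heis_product 0 1 0 g11 g12 g22 l1 0 0)
      (*s) (heis_product 0 1 0 0 (1/2) (d * l1 * g22) 1 0 0)" if "d \<noteq> 0" for d
      by (rule heis_isomorphicI[where ?a11.0 = "1 / l1" and ?a12.0 = 0 and ?a21.0 = 0 and ?a22.0 = d and
          t = "d / l1" and u = "d / l1 * (g12 - 1/2)" and d = "d / l1" and
          ?s1.0 = "- g11 / (2 * l1\<^sup>2)" and ?s2.0 = 0])
        (use that \<open>l1 \<noteq> 0\<close> in \<open>simp_all add: field_simps power2_eq_square\<close>)
    show ?thesis
    proof (cases "g22 = 0")
      case True
      with diag[of 1] show ?thesis by (metis W_normal_form.simps(10) mult_zero_right one_neq_zero)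
    next
      case False
      with diag[of "1 / (l1 * g22)"] that show ?thesis
        by (simp add: exI[of _ W08])
    qed
  qed
  consider (k) "k \<noteq> 0" | (l) "k = 0" "l1 \<noteq> 0" "l2 \<noteq> 0" | (l1) "k = 0" "l1 \<noteq> 0" "l2 = 0"
    | (l2) "k = 0" "l1 = 0" "l2 \<noteq> 0"
    using assms by metis
  then show ?thesis
  proof cases
    case k
    define q p2 p1 where "q = g12 - l1 * l2 / k" and "p2 = g22 - l2\<^sup>2 / k" and "p1 = g11 - l1\<^sup>2 / k"
    note shift = heis_shift[OF k, of 0 1 0 g11 g12 g22 l1 l2, folded q_def p1_def p2_def]
    have diag: "algebra_isomorphic (*s) (heis_product 0 1 0 p1 q p2 0 0 k)
       (*s) (heis_product 0 1 0 (a\<^sup>2 * k * p1) (1/2) (p2 / (a\<^sup>2 * k)) 0 0 1)" if "a \<noteq> 0" for a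
      by (rule heis_isomorphicI[where ?a11.0 = a and ?a12.0 = 0 and ?a21.0 = 0 and ?a22.0 = "1 / (a * k)" and
          t = "1 / k" and u = "(q - 1/2) / k" and d = "1 / k" and ?s1.0 = 0 and ?s2.0 = 0])
        (use that k in \<open>simp_all add: field_simps power2_eq_square\<close>)
    have "\<exists>l. algebra_isomorphic (*s) (heis_product 0 1 0 p1 q p2 0 0 k) (*s) (W_normal_form l)"
    proof (cases "p2 = 0")
      case False
      define a where "a = csqrt (p2 / k)"
      have a: "a\<^sup>2 * k = p2" using k by (simp add: a_def)
      then have "a \<noteq> 0" using False by auto
      from diag[OF this] False show ?thesis unfolding a by (metis divide_self W_normal_form.simps(6))
    next
      case p2: True
      show ?thesis
      proof (cases "p1 = 0")
        case True
        then show ?thesis using diag[of 1] p2 by (metis div_0 mult_zero_right one_neq_zero W_normal_form.simps(11))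
      next
        case False
        define a where "a = csqrt (1 / (k * p1))"
        have a: "a\<^sup>2 * k * p1 = 1" using k False by (simp add: a_def)
        then have "a \<noteq> 0" by auto
        from diag[OF this] show ?thesis unfolding a p2 by (metis div_0 W_normal_form.simps(7))
      qed
    qed
    then show ?thesis using algebra_isomorphic_trans[OF shift] by blast
  next
    case l
    have "algebra_isomorphic (*s) (heis_product 0 1 0 g11 g12 g22 l1 l2 k) (*s) (heis_product 0 1 0 0 (1/2) 0 1 1 0)"
      by (rule heis_isomorphicI[where ?a11.0 = "1 / l1" and ?a12.0 = 0 and ?a21.0 = 0 and ?a22.0 = "1 / l2" and
          t = "1 / (l1 * l2)" and u = "g12 / (l1 * l2) - g11 / (2 * l1\<^sup>2) - g22 / (2 * l2\<^sup>2) - 1 / (2 * l1 * l2)" and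
          d = "1 / (l1 * l2)" and
          ?s1.0 = "- g11 / (2 * l1\<^sup>2)" and ?s2.0 = "- g22 / (2 * l2\<^sup>2)"])
        (use l in \<open>simp_all add: field_simps power2_eq_square\<close>)
    then show ?thesis by (metis W_normal_form.simps(9))
  next
    case l1
    then show ?thesis using main by simp
  next
    case l2
    have "algebra_isomorphic (*s) (heis_product 0 1 0 g11 g12 g22 l1 l2 k)
      (*s) (heis_product 0 1 0 (- g22) (- g12) (- g11) (- l2) 0 0)"
      by (rule heis_isomorphicI[where ?a11.0 = 0 and ?a12.0 = 1 and ?a21.0 = 1 and ?a22.0 = 0 and
          t = 1 and u = 0 and d = "-1" and ?s1.0 = 0 and ?s2.0 = 0])
        (use l2 in simp_all)
    then show ?thesis using main[of "- l2"] l2(3) algebra_isomorphic_trans by (metis neg_equal_0_iff_equal)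
  qed
qed

section \<open>Identities in the two families, and normal forms of the filiform family\<close>

text \<open>The right identity for \<open>(yz)x\<close> and the left identity for \<open>x(yz)\<close> together give the derivation
  property of \<open>[x, \<cdot>]\<close>.\<close>

lemma symmetric_leibniz_imp_weakly_associative:
  assumes "symmetric_leibniz m"
  shows "weakly_associative m"
proof -
  have left: "m x (m y z) = m (m x y) z + m y (m x z)"
    and right: "m (m x y) z = m (m x z) y + m x (m y z)" for x y z
    using assms unfolding symmetric_leibniz_def by blast+
  have "m (m x y) z - m x (m y z) + m (m y z) x - m y (m z x) = m (m y x) z - m y (m x z)" for x y z
    unfolding left[of x y z] right[of y z x] by (simp add: algebra_simps)
  then show ?thesis unfolding weakly_associative_def by blast
qed

lemma two_step_nilpotent_imp_symmetric_leibniz: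
  "two_step_nilpotent m \<Longrightarrow> symmetric_leibniz m"
  by (simp add: two_step_nilpotent_def symmetric_leibniz_def)

text \<open>For a commutative product, adding the two identities yields \<open>2 y(xz) = 0\<close>.\<close>

lemma commutative_symmetric_leibniz_imp_two_step:
  assumes "complex_algebra sc m" and comm: "commutative_product m" and sl: "symmetric_leibniz m"
  shows "two_step_nilpotent m"
proof -
  interpret complex_algebra sc m by fact
  have comm: "m x y = m y x" for x y using comm unfolding commutative_product_def by blast
  have "m y (m x z) = 0" for x y z
  proof -
    have "m x (m y z) = m z (m x y) + m y (m x z)" "m z (m x y) = m y (m x z) + m x (m y z)"
      using sl comm unfolding symmetric_leibniz_def by metis+
    then have "m y (m x z) + m y (m x z) = 0"
      by (metis add.assoc add.commute add_cancel_right_right)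
    then have "sc 2 (m y (m x z)) = 0" by (metis scale_left_distrib scale_one one_add_one)
    then show ?thesis by simp
  qed
  then show ?thesis unfolding two_step_nilpotent_def using comm by metis
qed

lemma weakly_associative_heis: "weakly_associative (heis_product b11 b12 b22 g11 g12 g22 l1 l2 k)"
  unfolding weakly_associative_def by (simp add: vec4_eq_iff algebra_simps)

lemma not_commutative_heis: "\<not> commutative_product (heis_product b11 b12 b22 g11 g12 g22 l1 l2 k)"
proof
  assume "commutative_product (heis_product b11 b12 b22 g11 g12 g22 l1 l2 k)"
  then have "heis_product b11 b12 b22 g11 g12 g22 l1 l2 k (e 1) (e 2) $ 4 = heis_product b11 b12 b22 g11 g12 g22 l1 l2 k (e 2) (e 1) $ 4"
    unfolding commutative_product_def by metis
  then show False by (simp add: field_simps)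
qed

lemma two_step_nilpotent_heis:
  assumes "b11 = 0 \<and> b12 = 0 \<and> b22 = 0 \<or> l1 = 0 \<and> l2 = 0 \<and> k = 0"
  shows "two_step_nilpotent (heis_product b11 b12 b22 g11 g12 g22 l1 l2 k)"
  unfolding two_step_nilpotent_def using assms by (auto simp: vec4_eq_iff)

text \<open>The only products of three basis vectors that can be non-zero are \<open>(e i e j) e h = b(e i, e j) g(e 3, e h) e 4\<close>
  and their mirror images, so the identities amount to equations between the products of the values of \<open>b\<close> and those
  of \<open>g(e 3, \<cdot>)\<close>. They force all these products to vanish.\<close>

lemma symmetric_leibniz_heisD:
  assumes "symmetric_leibniz (heis_product b11 b12 b22 g11 g12 g22 l1 l2 k)"
  shows "b11 = 0 \<and> b12 = 0 \<and> b22 = 0 \<or> l1 = 0 \<and> l2 = 0 \<and> k = 0"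
proof -
  let ?m = "heis_product b11 b12 b22 g11 g12 g22 l1 l2 k"
  have left: "?m x (?m y z) $ 4 = ?m (?m x y) z $ 4 + ?m y (?m x z) $ 4" for x y z
    using assms unfolding symmetric_leibniz_def by (metis vector_add_component)
  have "b11 * k = 0" "b12 * k = 0" "b22 * k = 0"
    using left[of "e 3" "e 1" "e 1"] left[of "e 3" "e 1" "e 2"] left[of "e 3" "e 2" "e 2"] by auto
  moreover have "b11 * l1 = 0" "b11 * l2 = 0" "b12 * l1 = 0"
    using left[of "e 1" "e 1" "e 1"] left[of "e 1" "e 1" "e 2"] left[of "e 2" "e 1" "e 1"] by auto
  moreover have "b22 * l2 = 0" "b12 * l2 = 0" "b22 * l1 = 0"
    using left[of "e 2" "e 2" "e 2"] left[of "e 1" "e 2" "e 2"] left[of "e 2" "e 1" "e 2"] by auto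
  ultimately show ?thesis by auto
qed

lemma heis_isomorphic_W_alg:
  assumes "\<not> symmetric_leibniz (heis_product b11 b12 b22 g11 g12 g22 l1 l2 k)"
  shows "\<exists>l. algebra_isomorphic (*s) (heis_product b11 b12 b22 g11 g12 g22 l1 l2 k) (*s) (W_alg l)"
proof -
  have c: "\<not> (l1' = 0 \<and> l2' = 0 \<and> k' = 0)"
    if "algebra_isomorphic (*s) (heis_product b11 b12 b22 g11 g12 g22 l1 l2 k)
      (*s) (heis_product b11' b12' b22' g11' g12' g22' l1' l2' k')" for b11' b12' b22' g11' g12' g22' l1' l2' k'
    using assms algebra_isomorphic_imp_iff(3)[OF that]
      two_step_nilpotent_imp_symmetric_leibniz[OF two_step_nilpotent_heis] by blast
  have "b11 \<noteq> 0 \<or> b12 \<noteq> 0 \<or> b22 \<noteq> 0"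
    using assms two_step_nilpotent_imp_symmetric_leibniz[OF two_step_nilpotent_heis] by blast
  then have "\<exists>l. algebra_isomorphic (*s) (heis_product b11 b12 b22 g11 g12 g22 l1 l2 k) (*s) (W_normal_form l)"
  proof (rule heis_normalize_e3_form)
    fix g11' g12' g22' l1' l2' k'
    assume *: "algebra_isomorphic (*s) (heis_product b11 b12 b22 g11 g12 g22 l1 l2 k)
      (*s) (heis_product 1 0 0 g11' g12' g22' l1' l2' k')"
    from heis_rank1_isomorphic_normal_form[OF c[OF *]] show ?thesis using algebra_isomorphic_trans[OF *] by blast
  next
    fix g11' g12' g22' l1' l2' k'
    assume *: "algebra_isomorphic (*s) (heis_product b11 b12 b22 g11 g12 g22 l1 l2 k)
      (*s) (heis_product 0 1 0 g11' g12' g22' l1' l2' k')"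
    from heis_rank2_isomorphic_normal_form[OF c[OF *]] show ?thesis using algebra_isomorphic_trans[OF *] by blast
  qed
  then show ?thesis
    using algebra_isomorphic_sym[OF W_alg_isomorphic_normal_form] algebra_isomorphic_trans by blast
qed

fun S_normal_form :: "S_label \<Rightarrow> complex ^ 4 \<Rightarrow> complex ^ 4 \<Rightarrow> complex ^ 4" where
  "S_normal_form S01 = filiform_product 1 0 1"
| "S_normal_form S02 = filiform_product 1 0 0"
| "S_normal_form S03 = filiform_product 0 1 0"
| "S_normal_form S04 = filiform_product 0 0 1"
| "S_normal_form S05 = filiform_product 0 0 0"

lemma S_alg_eq_normal_form: "S_alg l = S_normal_form l"
  by (cases l) (simp_all add: fun_eq_iff vec4_eq_iff S_alg_def table_product_def sum_4 algebra_simps)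

text \<open>The binary form with coefficients \<open>p, q, r\<close> is normalised by substitutions that preserve the line
  of \<open>e 1\<close>. If \<open>p \<noteq> 0\<close>, complete the square; what then counts is whether the reduced last coefficient
  \<open>r - q\<^sup>2 / (4 p)\<close> vanishes. If \<open>p = 0\<close> and \<open>q \<noteq> 0\<close>, the last coefficient can be removed.\<close>

lemma filiform_isomorphic_S_alg: "\<exists>l. algebra_isomorphic (*s) (filiform_product p q r) (*s) (S_alg l)"
proof -
  consider "p \<noteq> 0" "r = q\<^sup>2 / (4 * p)" | "p \<noteq> 0" "r \<noteq> q\<^sup>2 / (4 * p)" | "p = 0" "q \<noteq> 0"
    | "p = 0" "q = 0" "r \<noteq> 0" | "p = 0" "q = 0" "r = 0" by blast
  then show ?thesis
  proof cases
    case 1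
    have "algebra_isomorphic (*s) (filiform_product p q r) (*s) (filiform_product 1 0 0)"
      by (rule filiform_isomorphicI[of 1 "1 / p" _ _ _ _ "- q / (2 * p)"])
        (use 1 in \<open>simp_all add: field_simps power2_eq_square\<close>)
    then show ?thesis unfolding S_alg_eq_normal_form by (metis S_normal_form.simps(2))
  next
    case 2
    define R where "R = r - q\<^sup>2 / (4 * p)"
    have "R \<noteq> 0" using 2 by (simp add: R_def)
    define a where "a = csqrt (p * R)"
    have a: "a\<^sup>2 = p * R" by (simp add: a_def)
    have "a \<noteq> 0" using a 2 \<open>R \<noteq> 0\<close> by auto
    have "algebra_isomorphic (*s) (filiform_product p q r) (*s) (filiform_product 1 0 1)"
    proof (rule filiform_isomorphicI[of a R _ _ _ _ "- a * q / (2 * p)"])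
      have "a\<^sup>2 * r + a * (- a * q / (2 * p)) * q + (- a * q / (2 * p))\<^sup>2 * p = a\<^sup>2 * R"
        using 2 by (simp add: R_def field_simps power2_eq_square)
      then show "a\<^sup>2 * R * 1 = a\<^sup>2 * r + a * (- a * q / (2 * p)) * q + (- a * q / (2 * p))\<^sup>2 * p"
        by simp
    qed (use 2 a \<open>R \<noteq> 0\<close> \<open>a \<noteq> 0\<close> in simp_all)
    then show ?thesis unfolding S_alg_eq_normal_form by (metis S_normal_form.simps(1))
  next
    case 3
    have "algebra_isomorphic (*s) (filiform_product p q r) (*s) (filiform_product 0 1 0)"
      by (rule filiform_isomorphicI[of q 1 _ _ _ _ "- r"])
        (use 3 in \<open>simp_all add: power2_eq_square\<close>)
    then show ?thesis unfolding S_alg_eq_normal_form by (metis S_normal_form.simps(3))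
  next
    case 4
    have "algebra_isomorphic (*s) (filiform_product p q r) (*s) (filiform_product 0 0 1)"
      by (rule filiform_isomorphicI[of 1 r _ _ _ _ 0]) (use 4 in simp_all)
    then show ?thesis unfolding S_alg_eq_normal_form by (metis S_normal_form.simps(4))
  next
    case 5
    then show ?thesis unfolding S_alg_eq_normal_form
      using algebra_isomorphic_refl[OF complex_algebra_filiform_product] by (metis S_normal_form.simps(5))
  qed
qed

lemma symmetric_leibniz_filiform: "symmetric_leibniz (filiform_product p q r)"
  unfolding symmetric_leibniz_def by (simp add: vec4_eq_iff algebra_simps)

lemma not_two_step_nilpotent_filiform: "\<not> two_step_nilpotent (filiform_product p q r)"
proof
  assume "two_step_nilpotent (filiform_product p q r)"
  then have "filiform_product p q r (e 2) (filiform_product p q r (e 1) (e 2)) $ 4 = 0"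
    unfolding two_step_nilpotent_def by simp
  then show False by simp
qed

lemma not_commutative_filiform: "\<not> commutative_product (filiform_product p q r)"
  using commutative_symmetric_leibniz_imp_two_step[OF complex_algebra_filiform_product] symmetric_leibniz_filiform
    not_two_step_nilpotent_filiform by blast

text \<open>The normal forms are separated by which of their coefficients vanish: for \<open>p\<close> this is an
  invariant, for \<open>q\<close> it is one among the forms with \<open>p = 0\<close>, and for \<open>r\<close> among those with \<open>q = 0\<close>.\<close>

lemma S_alg_isomorphic_imp_eq:
  assumes "algebra_isomorphic (*s) (S_alg l) (*s) (S_alg l')"
  shows "l = l'"
proof -
  have inv: "(p = 0 \<longleftrightarrow> p' = 0) \<and> (p = 0 \<and> p' = 0 \<longrightarrow> (q = 0 \<longleftrightarrow> q' = 0)) \<and>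
    (q = 0 \<and> q' = 0 \<longrightarrow> (r = 0 \<longleftrightarrow> r' = 0))"
    if "algebra_isomorphic (*s) (filiform_product p q r) (*s) (filiform_product p' q' r')" for p q r p' q' r'
    using that
  proof (rule filiform_isomorphicD)
    fix a b c
    assume nz: "a \<noteq> 0" "c \<noteq> 0"
      and p: "a\<^sup>2 * p' = c * p" and q: "a\<^sup>2 * q' = a * q + 2 * b * p"
      and r: "a\<^sup>2 * c * r' = a\<^sup>2 * r + a * b * q + b\<^sup>2 * p"
    have "p = 0 \<longleftrightarrow> p' = 0" using nz arg_cong[OF p, of "\<lambda>x. x = 0"] by simp
    moreover have "q = 0 \<longleftrightarrow> q' = 0" if "p = 0"
      using nz arg_cong[OF q, of "\<lambda>x. x = 0"] that by simp
    moreover have "r = 0 \<longleftrightarrow> r' = 0" if "q = 0" "q' = 0"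
    proof -
      have "b = 0 \<or> p = 0" using q that by simp
      then have "a\<^sup>2 * c * r' = a\<^sup>2 * r" using r that by auto
      then show ?thesis using nz by auto
    qed
    ultimately show ?thesis by metis
  qed
  show ?thesis
    using assms unfolding S_alg_eq_normal_form by - (cases l; cases l'; simp; drule inv; simp)
qed

section \<open>Distinguishing the normal forms\<close>

text \<open>A basis change that preserves the form \<open>b\<close> of rank 1 up to scalars has \<open>a12 = 0\<close>, because \<open>e 2\<close> spans
  the radical of \<open>b\<close>. In the resulting triangular equations one reads off what cannot change.\<close>

lemma heis_rank1_invariants:
  assumes "algebra_isomorphic (*s) (heis_product 1 0 0 0 g12 g22 l1 l2 k) (*s) (heis_product 1 0 0 0 g12' g22' l1' l2' k')"
  shows "(k = 0 \<longleftrightarrow> k' = 0) \<and> (k = 0 \<longrightarrow> (l2 = 0 \<longleftrightarrow> l2' = 0)) \<and>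
    (k = 0 \<and> l2 = 0 \<longrightarrow> (g22 = 0 \<longleftrightarrow> g22' = 0)) \<and>
    (k \<noteq> 0 \<and> l1 = 0 \<and> l2 = 0 \<and> l1' = 0 \<and> l2' = 0 \<longrightarrow>
      (g22 = 0 \<longleftrightarrow> g22' = 0) \<and> (g22 = 0 \<longrightarrow> g12 = g12'))"
  using assms
proof (rule heis_isomorphicD)
  fix a11 a12 a21 a22 s1 s2 t u d :: complex
  assume d: "d = a11 * a22 - a12 * a21" "d \<noteq> 0" and t: "t \<noteq> 0"
    and b: "t * 1 = 1 * a11\<^sup>2 + 2 * 0 * a11 * a21 + 0 * a21\<^sup>2"
      "t * 0 = 1 * a11 * a12 + 0 * (a11 * a22 + a21 * a12) + 0 * a21 * a22"
    and g: "u * 0 + d * g12' = 0 * a11 * a12 + g12 * (a11 * a22 + a21 * a12) + g22 * a21 * a22 +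
        s1 * (l1 * a12 + l2 * a22) + s2 * (l1 * a11 + l2 * a21) + k * s1 * s2"
    "u * 0 + d * g22' = 0 * a12\<^sup>2 + 2 * g12 * a12 * a22 + g22 * a22\<^sup>2 +
        2 * s2 * (l1 * a12 + l2 * a22) + k * s2\<^sup>2"
    and l: "d * l1' = t * (l1 * a11 + l2 * a21 + k * s1)" "d * l2' = t * (l1 * a12 + l2 * a22 + k * s2)"
    and k: "d * k' = t\<^sup>2 * k"
  have nz: "a12 = 0" "a11 \<noteq> 0" "a22 \<noteq> 0" using b d t by auto
  have k0: "k = 0 \<longleftrightarrow> k' = 0" using arg_cong[OF k, of "\<lambda>x. x = 0"] d(2) t by simp
  have l2: "d * l2' = t * (l2 * a22 + k * s2)" using l(2) nz by simp
  have g22: "d * g22' = g22 * a22\<^sup>2 + 2 * s2 * (l2 * a22) + k * s2\<^sup>2" using g(2) nz by simp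
  have "l2 = 0 \<longleftrightarrow> l2' = 0" if "k = 0"
    using arg_cong[OF l2, of "\<lambda>x. x = 0"] that d(2) t nz by simp
  moreover have "g22 = 0 \<longleftrightarrow> g22' = 0" if "k = 0" "l2 = 0"
    using arg_cong[OF g22, of "\<lambda>x. x = 0"] that d(2) nz by simp
  moreover have "(g22 = 0 \<longleftrightarrow> g22' = 0) \<and> (g22 = 0 \<longrightarrow> g12 = g12')"
    if "k \<noteq> 0" "l1 = 0" "l2 = 0" "l1' = 0" "l2' = 0"
  proof -
    have s: "s1 = 0" "s2 = 0" using l that t by simp_all
    have "g22 = 0 \<longleftrightarrow> g22' = 0"
      using arg_cong[OF g22, of "\<lambda>x. x = 0"] s d(2) nz by simp
    moreover have "g12 = g12'" if "g22 = 0"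
    proof -
      have "d * g12' = d * g12" using g(1) s nz d(1) that by simp
      then show ?thesis using d(2) by simp
    qed
    ultimately show ?thesis by blast
  qed
  ultimately show ?thesis using k0 by blast
qed

text \<open>A basis change that preserves the hyperbolic form \<open>b\<close> up to scalars preserves or exchanges its two
  isotropic lines, hence is diagonal or antidiagonal on \<open>\<langle>e 1, e 2\<rangle>\<close>. With \<open>l = 0\<close> the determinant
  cancels from the product \<open>g11 * g22\<close>, which makes it an invariant.\<close>

lemma heis_rank2_invariants:
  assumes "algebra_isomorphic (*s) (heis_product 0 1 0 g11 g12 g22 l1 l2 k) (*s) (heis_product 0 1 0 g11' g12' g22' l1' l2' k')"
  shows "(k = 0 \<longleftrightarrow> k' = 0) \<and>
    (k \<noteq> 0 \<and> l1 = 0 \<and> l2 = 0 \<and> l1' = 0 \<and> l2' = 0 \<longrightarrow>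
      g11 * g22 = g11' * g22' \<and> (g11 = 0 \<and> g22 = 0 \<longleftrightarrow> g11' = 0 \<and> g22' = 0)) \<and>
    (k = 0 \<longrightarrow> (l1 * l2 = 0 \<longleftrightarrow> l1' * l2' = 0)) \<and>
    (k = 0 \<and> l1' \<noteq> 0 \<and> l2 = 0 \<longrightarrow> (g22 = 0 \<longleftrightarrow> g22' = 0))"
  using assms
proof (rule heis_isomorphicD)
  fix a11 a12 a21 a22 s1 s2 t u d :: complex
  assume d: "d = a11 * a22 - a12 * a21" "d \<noteq> 0" and t: "t \<noteq> 0"
    and b: "t * 0 = 0 * a11\<^sup>2 + 2 * 1 * a11 * a21 + 0 * a21\<^sup>2"
      "t * 1 = 0 * a11 * a12 + 1 * (a11 * a22 + a21 * a12) + 0 * a21 * a22"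
      "t * 0 = 0 * a12\<^sup>2 + 2 * 1 * a12 * a22 + 0 * a22\<^sup>2"
    and g: "u * 0 + d * g11' = g11 * a11\<^sup>2 + 2 * g12 * a11 * a21 + g22 * a21\<^sup>2 +
        2 * s1 * (l1 * a11 + l2 * a21) + k * s1\<^sup>2"
    "u * 0 + d * g22' = g11 * a12\<^sup>2 + 2 * g12 * a12 * a22 + g22 * a22\<^sup>2 +
        2 * s2 * (l1 * a12 + l2 * a22) + k * s2\<^sup>2"
    and l: "d * l1' = t * (l1 * a11 + l2 * a21 + k * s1)" "d * l2' = t * (l1 * a12 + l2 * a22 + k * s2)"
    and k: "d * k' = t\<^sup>2 * k"
  have k0: "k = 0 \<longleftrightarrow> k' = 0" using arg_cong[OF k, of "\<lambda>x. x = 0"] d(2) t by simp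
  consider "a21 = 0" "a12 = 0" "a11 \<noteq> 0" "a22 \<noteq> 0" "t = a11 * a22" "d = t"
    | "a11 = 0" "a22 = 0" "a21 \<noteq> 0" "a12 \<noteq> 0" "t = a21 * a12" "d = - t"
    using b d by (auto simp: mult.commute)
  then show ?thesis
  proof cases
    case 1
    have l': "l1' = l1 * a11 + k * s1" "l2' = l2 * a22 + k * s2" using l 1 t by simp_all
    have g': "d * g11' = g11 * a11\<^sup>2 + 2 * s1 * (l1 * a11) + k * s1\<^sup>2"
      "d * g22' = g22 * a22\<^sup>2 + 2 * s2 * (l2 * a22) + k * s2\<^sup>2" using g 1 by simp_all
    have "l1 * l2 = 0 \<longleftrightarrow> l1' * l2' = 0" if "k = 0" using l' that 1 by simp
    moreover have "g22 = 0 \<longleftrightarrow> g22' = 0" if "k = 0" "l2 = 0"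
      using arg_cong[OF g'(2), of "\<lambda>x. x = 0"] that d(2) 1 by simp
    moreover have "g11 * g22 = g11' * g22' \<and> (g11 = 0 \<and> g22 = 0 \<longleftrightarrow> g11' = 0 \<and> g22' = 0)"
      if "k \<noteq> 0" "l1 = 0" "l2 = 0" "l1' = 0" "l2' = 0"
    proof -
      have "s1 = 0" "s2 = 0" using l' that by simp_all
      then have g'': "d * g11' = g11 * a11\<^sup>2" "d * g22' = g22 * a22\<^sup>2" using g' by simp_all
      have "d\<^sup>2 * (g11' * g22') = (d * g11') * (d * g22')" by (simp add: power2_eq_square)
      also have "\<dots> = d\<^sup>2 * (g11 * g22)" unfolding g'' using 1 by (simp add: power2_eq_square)
      finally have "g11 * g22 = g11' * g22'" using d(2) by simp
      moreover have "g11 = 0 \<longleftrightarrow> g11' = 0" "g22 = 0 \<longleftrightarrow> g22' = 0"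
        using arg_cong[OF g''(1), of "\<lambda>x. x = 0"] arg_cong[OF g''(2), of "\<lambda>x. x = 0"] d(2) 1 by simp_all
      ultimately show ?thesis by blast
    qed
    ultimately show ?thesis using k0 by blast
  next
    case 2
    have l': "- l1' = l2 * a21 + k * s1" "- l2' = l1 * a12 + k * s2"
      using l 2 t by (metis add_0_left mult_cancel_left mult_minus_left mult_minus_right mult_zero_right add_0_right)+
    have g': "d * g11' = g22 * a21\<^sup>2 + 2 * s1 * (l2 * a21) + k * s1\<^sup>2"
      "d * g22' = g11 * a12\<^sup>2 + 2 * s2 * (l1 * a12) + k * s2\<^sup>2" using g 2 by simp_all
    have "l1 * l2 = 0 \<longleftrightarrow> l1' * l2' = 0" if "k = 0"
    proof -
      have "l1' * l2' = (l2 * a21) * (l1 * a12)" using l' that by (metis add_0_right minus_mult_minus mult_zero_left)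
      then show ?thesis using 2 by auto
    qed
    moreover have False if "k = 0" "l1' \<noteq> 0" "l2 = 0" using l' that by simp
    moreover have "g11 * g22 = g11' * g22' \<and> (g11 = 0 \<and> g22 = 0 \<longleftrightarrow> g11' = 0 \<and> g22' = 0)"
      if "k \<noteq> 0" "l1 = 0" "l2 = 0" "l1' = 0" "l2' = 0"
    proof -
      have "s1 = 0" "s2 = 0" using l' that by simp_all
      then have g'': "d * g11' = g22 * a21\<^sup>2" "d * g22' = g11 * a12\<^sup>2" using g' by simp_all
      have "d\<^sup>2 * (g11' * g22') = (d * g11') * (d * g22')" by (simp add: power2_eq_square)
      also have "\<dots> = d\<^sup>2 * (g11 * g22)" unfolding g'' using 2 by (simp add: power2_eq_square)
      finally have "g11 * g22 = g11' * g22'" using d(2) by simp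
      moreover have "g22 = 0 \<longleftrightarrow> g11' = 0" "g11 = 0 \<longleftrightarrow> g22' = 0"
        using arg_cong[OF g''(1), of "\<lambda>x. x = 0"] arg_cong[OF g''(2), of "\<lambda>x. x = 0"] d(2) 2 by simp_all
      ultimately show ?thesis by blast
    qed
    ultimately show ?thesis using k0 by blast
  qed
qed

lemma heis_rank1_not_isomorphic_rank2:
  "\<not> algebra_isomorphic (*s) (heis_product 1 0 0 g11 g12 g22 l1 l2 k) (*s) (heis_product 0 1 0 g11' g12' g22' l1' l2' k')"
proof
  assume "algebra_isomorphic (*s) (heis_product 1 0 0 g11 g12 g22 l1 l2 k) (*s) (heis_product 0 1 0 g11' g12' g22' l1' l2' k')"
  then show False
    by (rule heis_isomorphicD) simp
qed

lemma W_alg_isomorphic_imp_eq: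
  assumes "algebra_isomorphic (*s) (W_alg l) (*s) (W_alg l')"
  shows "l = l' \<or> {l, l'} = {W06 0, W07}"
proof -
  have iso: "algebra_isomorphic (*s) (W_normal_form l) (*s) (W_normal_form l')"
    using assms W_alg_isomorphic_normal_form algebra_isomorphic_sym algebra_isomorphic_trans by metis
  have no: "\<not> algebra_isomorphic (*s) (heis_product 0 1 0 g11' g12' g22' l1' l2' k') (*s) (heis_product 1 0 0 g11 g12 g22 l1 l2 k)"
    for g11 g12 g22 l1 l2 k g11' g12' g22' l1' l2' k'
    using heis_rank1_not_isomorphic_rank2 algebra_isomorphic_sym by metis
  show ?thesis
    using iso
    by - (cases l; cases l'; simp add: heis_rank1_not_isomorphic_rank2 no;
      (drule heis_rank1_invariants | drule heis_rank2_invariants); auto)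
qed

section \<open>The classification\<close>

text \<open>A product of \<open>2, 3, 5, 9\<close> elements lies in the second to fifth term of the flag: one of the two
  factors of a product of \<open>2 n + 1\<close> elements is itself a product of more than \<open>n\<close> elements.\<close>

lemma nilpotent_triangular:
  fixes m :: "complex ^ 4 \<Rightarrow> complex ^ 4 \<Rightarrow> complex ^ 4"
  assumes m: "\<And>x y. m x y $ 1 = 0"
    "\<And>x y. x $ 1 = 0 \<or> y $ 1 = 0 \<Longrightarrow> m x y $ 2 = 0"
    "\<And>x y. x $ 1 = 0 \<and> x $ 2 = 0 \<or> y $ 1 = 0 \<and> y $ 2 = 0 \<Longrightarrow> m x y $ 3 = 0"
    "\<And>x y. x $ 1 = 0 \<and> x $ 2 = 0 \<and> x $ 3 = 0 \<or> y $ 1 = 0 \<and> y $ 2 = 0 \<and> y $ 3 = 0 \<Longrightarrow>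
      m x y $ 4 = 0"
  shows "nilpotent_product m"
proof -
  have "(k \<ge> 2 \<longrightarrow> a $ 1 = 0) \<and> (k \<ge> 3 \<longrightarrow> a $ 2 = 0) \<and> (k \<ge> 5 \<longrightarrow> a $ 3 = 0) \<and>
    (k \<ge> 9 \<longrightarrow> a $ 4 = 0)" if "bracketed_product m k a" for k a
    using that
  proof induction
    case (mult i a j b)
    show ?case
    proof (intro conjI impI)
      show "m a b $ 1 = 0" by (rule m)
    next
      assume "i + j \<ge> 3"
      then have "i \<ge> 2 \<or> j \<ge> 2" by arith
      then show "m a b $ 2 = 0" using mult.IH by (intro m) auto
    next
      assume "i + j \<ge> 5"
      then have "i \<ge> 3 \<or> j \<ge> 3" by arith
      then show "m a b $ 3 = 0" using mult.IH by (intro m) auto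
    next
      assume "i + j \<ge> 9"
      then have "i \<ge> 5 \<or> j \<ge> 5" by arith
      then show "m a b $ 4 = 0" using mult.IH by (intro m) auto
    qed
  qed simp
  from this[of 9] have "a = 0" if "bracketed_product m 9 a" for a
    using that by (simp add: vec4_eq_iff)
  then show ?thesis unfolding nilpotent_product_def by (intro exI[of _ 9]) simp
qed

lemma nilpotent_S_alg: "nilpotent_product (S_alg l)"
  by (rule nilpotent_triangular; cases l) (auto simp: S_alg_eq_normal_form)

lemma nilpotent_W_alg: "nilpotent_product (W_alg l)"
  by (rule nilpotent_triangular; cases l) (auto simp: W_alg_def table_product_def sum_4)

lemma W_alg_properties:
  "complex_algebra4 (*s) (W_alg l)" "weakly_associative (W_alg l)"
  "\<not> commutative_product (W_alg l)" "\<not> symmetric_leibniz (W_alg l)"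
proof -
  show "complex_algebra4 (*s) (W_alg l)"
    unfolding complex_algebra4_vec_iff W_alg_def by (rule complex_algebra_table_product)
  note iso = algebra_isomorphic_imp_iff[OF W_alg_isomorphic_normal_form]
  show "weakly_associative (W_alg l)"
    unfolding iso by (cases l) (simp_all add: weakly_associative_heis)
  show "\<not> commutative_product (W_alg l)"
    unfolding iso by (cases l) (simp_all add: not_commutative_heis)
  show "\<not> symmetric_leibniz (W_alg l)"
    unfolding iso by (cases l) (auto dest!: symmetric_leibniz_heisD)
qed

lemma S_alg_properties:
  "complex_algebra4 (*s) (S_alg l)" "symmetric_leibniz (S_alg l)" "\<not> two_step_nilpotent (S_alg l)"
proof -
  show "complex_algebra4 (*s) (S_alg l)"
    unfolding complex_algebra4_vec_iff S_alg_def by (rule complex_algebra_table_product)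
  show "symmetric_leibniz (S_alg l)" "\<not> two_step_nilpotent (S_alg l)"
    unfolding S_alg_eq_normal_form
    by (cases l; simp add: symmetric_leibniz_filiform not_two_step_nilpotent_filiform)+
qed

lemma symmetric_leibniz_nilpotent4_cases:
  assumes alg: "complex_algebra4 sc mul" and nil: "nilpotent_product mul" and sl: "symmetric_leibniz mul"
  shows "two_step_nilpotent mul \<or> (\<exists>l. algebra_isomorphic sc mul (*s) (S_alg l))"
  using alg nil symmetric_leibniz_imp_weakly_associative[OF sl]
proof (cases rule: weakly_associative_nilpotent4_cases)
  case 1
  then show ?thesis
    using commutative_symmetric_leibniz_imp_two_step[of sc] alg sl unfolding complex_algebra4_def by blast
next
  case (2 b11 b12 b22 g11 g12 g22 l1 l2 k)
  then have "symmetric_leibniz (heis_product b11 b12 b22 g11 g12 g22 l1 l2 k)"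
    using sl algebra_isomorphic_imp_iff(3) by blast
  then show ?thesis
    using two_step_nilpotent_heis[OF symmetric_leibniz_heisD] algebra_isomorphic_imp_iff(4)[OF 2] by blast
next
  case (3 p q r)
  then show ?thesis using filiform_isomorphic_S_alg algebra_isomorphic_trans by blast
qed

lemma weakly_associative_nilpotent4_classification:
  assumes alg: "complex_algebra4 sc mul" and nil: "nilpotent_product mul" and wa: "weakly_associative mul"
  shows "commutative_product mul \<or> symmetric_leibniz mul \<or>
    (\<exists>l. algebra_isomorphic sc mul (*s) (W_alg l))"
  using alg nil wa
proof (cases rule: weakly_associative_nilpotent4_cases)
  case (2 b11 b12 b22 g11 g12 g22 l1 l2 k)
  then show ?thesis
    using heis_isomorphic_W_alg algebra_isomorphic_trans[OF 2] algebra_isomorphic_imp_iff(3)[OF 2] by blast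
next
  case (3 p q r)
  then show ?thesis using symmetric_leibniz_filiform algebra_isomorphic_imp_iff(3)[OF 3] by blast
qed simp

definition iso_class4 where
  "iso_class4 P m = {m'. complex_algebra4 (*s) m' \<and> P m' \<and> algebra_isomorphic (*s) m (*s) m'}"
  for m :: "complex ^ 4 \<Rightarrow> complex ^ 4 \<Rightarrow> complex ^ 4"

lemma iso_classes4_eq: "iso_classes4 P = iso_class4 P ` {m. complex_algebra4 (*s) m \<and> P m}"
  unfolding iso_classes4_def quotient_def iso_class4_def by (auto simp: Image_def)

lemma iso_class4_eq_iff:
  assumes "complex_algebra4 (*s) m" "P m" "complex_algebra4 (*s) m'" "P m'"
  shows "iso_class4 P m = iso_class4 P m' \<longleftrightarrow> algebra_isomorphic (*s) m (*s) m'"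
proof
  assume "iso_class4 P m = iso_class4 P m'"
  moreover have "m' \<in> iso_class4 P m'"
    using assms algebra_isomorphic_refl unfolding iso_class4_def complex_algebra4_def by blast
  ultimately show "algebra_isomorphic (*s) m (*s) m'" by (auto simp: iso_class4_def)
next
  assume "algebra_isomorphic (*s) m (*s) m'"
  then show "iso_class4 P m = iso_class4 P m'"
    unfolding iso_class4_def using algebra_isomorphic_sym algebra_isomorphic_trans by blast
qed

lemma card_iso_classes4_S:
  "card (iso_classes4 (\<lambda>m. nilpotent_product m \<and> symmetric_leibniz m \<and> \<not> two_step_nilpotent m)) = 5"
proof -
  define P where "P = (\<lambda>m :: complex ^ 4 \<Rightarrow> complex ^ 4 \<Rightarrow> complex ^ 4.
    nilpotent_product m \<and> symmetric_leibniz m \<and> \<not> two_step_nilpotent m)"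
  have S: "complex_algebra4 (*s) (S_alg l)" "P (S_alg l)" for l
    using S_alg_properties[of l] nilpotent_S_alg[of l] by (simp_all add: P_def)
  have "iso_classes4 P = (\<lambda>l. iso_class4 P (S_alg l)) ` UNIV"
  proof -
    have "iso_class4 P m \<in> range (\<lambda>l. iso_class4 P (S_alg l))"
      if m: "complex_algebra4 (*s) m" "P m" for m
    proof -
      from m obtain l where "algebra_isomorphic (*s) m (*s) (S_alg l)"
        using symmetric_leibniz_nilpotent4_cases[OF m(1)] by (auto simp: P_def)
      then have "iso_class4 P m = iso_class4 P (S_alg l)"
        using iso_class4_eq_iff[of m P "S_alg l"] m S by blast
      then show ?thesis by blast
    qed
    then show ?thesis unfolding iso_classes4_eq using S by blast
  qed
  moreover have "inj (\<lambda>l. iso_class4 P (S_alg l))"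
    by (rule injI) (use iso_class4_eq_iff[of _ P] S S_alg_isomorphic_imp_eq in blast)
  moreover have "card (UNIV :: S_label set) = 5"
  proof -
    have "(UNIV :: S_label set) = {S01, S02, S03, S04, S05}"
      using S_label.exhaust by auto
    then have "card (UNIV :: S_label set) = card {S01, S02, S03, S04, S05}" by (rule arg_cong)
    then show ?thesis by simp
  qed
  ultimately show ?thesis unfolding P_def[symmetric] by (simp add: card_image)
qed

lemma infinite_iso_classes4_W:
  "infinite (iso_classes4 (\<lambda>m. nilpotent_product m \<and> weakly_associative m \<and>
     \<not> commutative_product m \<and> \<not> symmetric_leibniz m))"
proof -
  define P where "P = (\<lambda>m :: complex ^ 4 \<Rightarrow> complex ^ 4 \<Rightarrow> complex ^ 4.
    nilpotent_product m \<and> weakly_associative m \<and> \<not> commutative_product m \<and> \<not> symmetric_leibniz m)"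
  have W: "complex_algebra4 (*s) (W_alg l)" "P (W_alg l)" for l
    using W_alg_properties[of l] nilpotent_W_alg[of l] by (simp_all add: P_def)
  have "inj (\<lambda>\<alpha>. iso_class4 P (W_alg (W03 \<alpha>)))"
  proof (rule injI)
    fix \<alpha> \<beta> assume "iso_class4 P (W_alg (W03 \<alpha>)) = iso_class4 P (W_alg (W03 \<beta>))"
    then have "algebra_isomorphic (*s) (W_alg (W03 \<alpha>)) (*s) (W_alg (W03 \<beta>))"
      using iso_class4_eq_iff[of _ P] W by blast
    from W_alg_isomorphic_imp_eq[OF this] show "\<alpha> = \<beta>" by auto
  qed
  then have "infinite (range (\<lambda>\<alpha>. iso_class4 P (W_alg (W03 \<alpha>))))"
    using finite_imageD infinite_UNIV_char_0 by blast
  moreover have "range (\<lambda>\<alpha>. iso_class4 P (W_alg (W03 \<alpha>))) \<subseteq> iso_classes4 P"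
    unfolding iso_classes4_eq using W by blast
  ultimately show ?thesis unfolding P_def[symmetric] using finite_subset by blast
qed

theorem theoremA:
  shows
   "(card (iso_classes4 (\<lambda>m. nilpotent_product m \<and> symmetric_leibniz m \<and>
                            \<not> two_step_nilpotent m)) = 5 \<and>
     (\<forall>l. complex_algebra4 (*s) (S_alg l) \<and> nilpotent_product (S_alg l) \<and>
          symmetric_leibniz (S_alg l) \<and> \<not> two_step_nilpotent (S_alg l)) \<and>
     (\<forall>l l'. algebra_isomorphic (*s) (S_alg l) (*s) (S_alg l') \<longrightarrow> l = l') \<and>
     (\<forall>(sc :: complex \<Rightarrow> 'a::ab_group_add \<Rightarrow> 'a) mul.
        complex_algebra4 sc mul \<and> nilpotent_product mul \<and> symmetric_leibniz mul \<longrightarrow>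
        two_step_nilpotent mul \<or>
        (\<exists>l. algebra_isomorphic sc mul (*s) (S_alg l)))) \<and>
    (infinite (iso_classes4 (\<lambda>m. nilpotent_product m \<and> weakly_associative m \<and>
                                \<not> commutative_product m \<and> \<not> symmetric_leibniz m)) \<and>
     (\<forall>l. complex_algebra4 (*s) (W_alg l) \<and> nilpotent_product (W_alg l) \<and>
          weakly_associative (W_alg l) \<and> \<not> commutative_product (W_alg l) \<and>
          \<not> symmetric_leibniz (W_alg l)) \<and>
     (\<forall>l l'. algebra_isomorphic (*s) (W_alg l) (*s) (W_alg l') \<longrightarrow>
             l = l' \<or> {l, l'} = {W06 0, W07}) \<and>
     (\<forall>(sc :: complex \<Rightarrow> 'a::ab_group_add \<Rightarrow> 'a) mul.
        complex_algebra4 sc mul \<and> nilpotent_product mul \<and> weakly_associative mul \<longrightarrow>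
        commutative_product mul \<or>
        (\<not> commutative_product mul \<and> symmetric_leibniz mul) \<or>
        (\<exists>l. algebra_isomorphic sc mul (*s) (W_alg l))))"
  by (intro conjI) (use S_alg_properties W_alg_properties nilpotent_S_alg nilpotent_W_alg
    S_alg_isomorphic_imp_eq W_alg_isomorphic_imp_eq card_iso_classes4_S infinite_iso_classes4_W
    symmetric_leibniz_nilpotent4_cases weakly_associative_nilpotent4_classification in blast)+

end
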